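(* The number $t_n$ of tree interval posets with $n$ minimal elements is \[ t_n=\begin{cases}1 & \text{if } n=1,\\[4pt] \displaystyle\frac{1}{n}\left[\sum_{i=1}^{n-3}\ \sum_{k=1}^{\min\{i,\frac{n-i-1}{2}\}}\binom{n+i-1}{i}\binom{i}{k}\binom{n-i-k-2}{k-1}+\binom{2n-2}{n-1}\right] & \text{if } n>1.\end{cases} \]
   Context: A permutation $\sigma=\sigma(1)\dots\sigma(n)$ of size $n$ is a word on $\{1,\dots,n\}$ containing each letter exactly once. A non-empty interval of $\sigma$ is a set of values $[j,j+h]=\{j,\dots,j+h\}$ such that $\{\sigma(i),\dots,\sigma(i+h)\}=[j,j+h]$ for some $i$. $P(\sigma)$ is the poset of all non-empty intervals of $\sigma$ (including singletons and $[1,n]$, excluding the empty set) ordered by inclusion. An interval poset is a poset of the form $P(\sigma)$; two interval posets are equal (counted once) when they are equal as sets of intervals ordered by inclusion (not merely isomorphic). $P(\sigma)$ has $n$ minimal elements (the singletons) exactly when $\sigma$ has size $n$. A tree interval poset is an interval poset $P(\sigma)$ whose Hasse diagram (the graph of covering relations) is a tree. The inner sum runs over integers $k$ with $1\le k\le\min\{i,\frac{n-i-1}{2}\}$; empty sums are $0$. *)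

theory Defs
  imports Complex_Main "HOL-Combinatorics.Permutations" "Graph_Theory.Graph_Theory"
begin

section \<open>Posets and their Hasse diagrams\<close>

text \<open>
  A poset is given by its reflexive order relation \<open>r\<close>, as in \<^const>\<open>partial_order_on\<close>;
  its carrier is \<^term>\<open>Field r\<close>.
\<close>

definition minimal_elements :: "'a rel \<Rightarrow> 'a set" where
  "minimal_elements r = {x \<in> Field r. \<forall>y. (y, x) \<in> r \<longrightarrow> y = x}"

definition covering :: "'a rel \<Rightarrow> 'a rel" where
  "covering r = {(x, y). (x, y) \<in> r \<and> x \<noteq> y \<and>
     \<not> (\<exists>z. (x, z) \<in> r \<and> (z, y) \<in> r \<and> z \<noteq> x \<and> z \<noteq> y)}"

definition hasse_diagram :: "'a rel \<Rightarrow> 'a pair_pre_digraph" where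
  "hasse_diagram r = \<lparr> pverts = Field r, parcs = covering r \<rparr>"

text \<open>
  The library's \<^const>\<open>Digraph_Component.tree\<close> only excludes \<^emph>\<open>directed\<close> cycles, of which a Hasse
  diagram never has any. Here the underlying undirected graph has to be a tree. It is
  represented by \<^const>\<open>mk_symmetric\<close>, where every edge traversed back and forth counts as a
  \<^const>\<open>pre_digraph.cycle\<close> of length 2; as the graph is simple, its genuine cycles are those
  of length at least 3.
\<close>

definition undirected_tree :: "('a, 'b) pre_digraph \<Rightarrow> bool" where
  "undirected_tree G \<longleftrightarrow> Digraph_Component.connected G \<and>
     \<not> (\<exists>p. pre_digraph.cycle (with_proj (mk_symmetric G)) p \<and> 3 \<le> length p)"


section \<open>Interval posets of permutations\<close>

text \<open>
  A permutation \<open>\<sigma>(1) \<dots> \<sigma>(n)\<close> of size \<open>n\<close> is a function \<open>\<sigma>\<close> with \<open>\<sigma> permutes {1..n}\<close>.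
  Intervals are sets of values.
\<close>

definition intervals :: "nat \<Rightarrow> (nat \<Rightarrow> nat) \<Rightarrow> nat set set" where
  "intervals n \<sigma> = {I. \<exists>i j h. 1 \<le> i \<and> i + h \<le> n \<and> I = {j..j + h} \<and> \<sigma> ` {i..i + h} = I}"

definition interval_poset :: "nat \<Rightarrow> (nat \<Rightarrow> nat) \<Rightarrow> nat set rel" where
  "interval_poset n \<sigma> = {(I, J). I \<in> intervals n \<sigma> \<and> J \<in> intervals n \<sigma> \<and> I \<subseteq> J}"

lemma Field_interval_poset: "Field (interval_poset n \<sigma>) = intervals n \<sigma>"
  by (auto simp: interval_poset_def Field_def)

lemma partial_order_on_interval_poset:
  "partial_order_on (intervals n \<sigma>) (interval_poset n \<sigma>)"
  by (auto simp: interval_poset_def partial_order_on_def preorder_on_def refl_on_def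
      trans_def antisym_def)

definition is_interval_poset :: "nat set rel \<Rightarrow> bool" where
  "is_interval_poset P \<longleftrightarrow> (\<exists>n \<sigma>. \<sigma> permutes {1..n} \<and> P = interval_poset n \<sigma>)"

definition is_tree_interval_poset :: "nat set rel \<Rightarrow> bool" where
  "is_tree_interval_poset P \<longleftrightarrow>
     is_interval_poset P \<and> undirected_tree (with_proj (hasse_diagram P))"

definition num_tree_interval_posets :: "nat \<Rightarrow> nat" where
  "num_tree_interval_posets n =
     card {P. is_tree_interval_poset P \<and> card (minimal_elements P) = n}"

end

theory Submission
  imports Defs "HOL-Computational_Algebra.Formal_Power_Series"
begin

text \<open>
  In a finite poset with a greatest element the Hasse diagram is connected, and it is acyclic exactly
  if no element has two upper covers, that is, if the elements above any given one form a chain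
  (\<open>undirected_tree_hasse_diagram_iff\<close>). In \<open>P(\<sigma>)\<close> every interval lies above singletons, so the
  Hasse diagram is a tree exactly if any two intervals are nested or disjoint
  (\<open>tree_interval_poset_iff_laminar\<close>). Such a laminar family of intervals of \<open>{1..n}\<close>, containing the
  singletons and \<open>{1..n}\<close> itself, consists of the sets of leaves below the nodes of a plane tree with
  leaves \<open>1, \<dots>, n\<close> and without unary nodes.

  A node never has exactly three children: these are three consecutive blocks of values that together
  occupy consecutive positions, and the block in the middle position is adjacent in position to both
  others, in value to at least one of them. With that one it forms an interval strictly between a
  child and its parent (\<open>intervals_three_blocks\<close>). Nothing else is forbidden
  (\<open>spans_realised_by_word\<close>). For \<open>k \<ge> 4\<close> children, words for the subtrees are substituted into a
  permutation of size \<open>k\<close> that is simple, so that an interval meeting two blocks meets all of them.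
  For two children the words are concatenated; a spurious interval would consist of a final piece of
  the first word and an initial piece of the second one, and there is none if both words are
  indecomposable as direct sums. The reversal of the concatenation has the same intervals and is
  again indecomposable, which keeps the recursion going. A plane tree is determined by the leaf sets
  of its nodes (\<open>spans_inject\<close>), so \<open>t\<^sub>n\<close> counts the plane trees with \<open>n\<close> leaves in which each
  inner node has two or at least four children (\<open>num_tree_interval_posets_eq\<close>).

  The generating function \<open>T\<close> of these trees satisfies \<open>T = x + T\<^sup>2 + T\<^sup>4 + T\<^sup>5 + \<dots>\<close>, which is
  \<open>T = x \<phi>(T)\<close> with \<open>\<phi>(y) = 1 / (1 - u)\<close> and \<open>u = y + y\<^sup>3 / (1 - y)\<close>. Lagrange inversion
  (\<open>lagrange_inversion\<close>) turns \<open>n t\<^sub>n\<close> into the coefficient of \<open>y\<close> with exponent \<open>n - 1\<close> in the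
  \<open>n\<close>-th power of \<open>\<phi>\<close>. In the formula, \<open>i\<close> is the exponent of \<open>u\<close> in the binomial series for that
  power and \<open>k\<close> is the number of factors \<open>u\<close> that contribute \<open>y\<^sup>3 / (1 - y)\<close>. For \<open>k = 0\<close> only
  \<open>i = n - 1\<close> contributes; this is the central binomial coefficient.
\<close>


section \<open>Posets whose Hasse diagram is a tree\<close>

text \<open>
  Of the elements above \<open>x\<close> and at most \<open>y\<close>, one with the fewest elements below it covers \<open>x\<close>.
\<close>

lemma covering_above:
  assumes po: "partial_order_on (Field r) r" and fin: "finite (Field r)"
    and xy: "(x, y) \<in> r" "x \<noteq> y"
  obtains c where "(x, c) \<in> covering r" "(c, y) \<in> r"
proof -
  have tr: "trans r" and as: "antisym r"
    using po by (auto simp: partial_order_on_def preorder_on_def)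
  define B where "B = {z. (x, z) \<in> r \<and> x \<noteq> z \<and> (z, y) \<in> r}"
  define below where "below z = {w. (w, z) \<in> r}" for z
  have yB: "y \<in> B"
    using po xy by (auto simp: B_def partial_order_on_def preorder_on_def refl_on_def Field_def)
  have fin_below: "finite (below z)" for z
    by (rule finite_subset[OF _ fin]) (auto simp: below_def Field_def)
  obtain c where c: "c \<in> B" and min: "\<And>z. z \<in> B \<Longrightarrow> card (below c) \<le> card (below z)"
    using ex_has_least_nat[of "\<lambda>z. z \<in> B" y "\<lambda>z. card (below z)"] yB by blast
  have "\<not> (\<exists>z. (x, z) \<in> r \<and> (z, c) \<in> r \<and> z \<noteq> x \<and> z \<noteq> c)"
  proof safe
    fix z assume z: "(x, z) \<in> r" "(z, c) \<in> r" "z \<noteq> x" "z \<noteq> c"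
    have "z \<in> B" using z c tr by (auto simp: B_def dest: transD)
    have "c \<in> below c"
      using c po by (auto simp: B_def below_def partial_order_on_def preorder_on_def refl_on_def Field_def)
    moreover have "c \<notin> below z" using z as by (auto simp: below_def dest: antisymD)
    moreover have "below z \<subseteq> below c" using z tr by (auto simp: below_def dest: transD)
    ultimately have "card (below z) < card (below c)"
      by (intro psubset_card_mono fin_below) auto
    then show False using min[OF \<open>z \<in> B\<close>] by simp
  qed
  then have "(x, c) \<in> covering r" using c by (auto simp: covering_def B_def)
  then show ?thesis using that c by (auto simp: B_def)
qed

text \<open>
  Climbing from cover to cover ends in \<open>y\<close> because the number of elements above the current one
  decreases. That all vertices of the walk lie between \<open>x\<close> and \<open>y\<close> is what later shows that two such
  walks meet only in their common end.
\<close>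

lemma saturated_chain:
  assumes po: "partial_order_on (Field r) r" and fin: "finite (Field r)"
    and xy: "(x, y) \<in> r"
  shows "\<exists>p. pcas x p y \<and> set p \<subseteq> covering r \<and> distinct (pawalk_verts x p)
      \<and> (\<forall>v\<in>set (pawalk_verts x p). (x, v) \<in> r \<and> (v, y) \<in> r)"
  using xy
proof (induction "card {w. (x, w) \<in> r}" arbitrary: x rule: less_induct)
  case less
  have tr: "trans r" and as: "antisym r" and rx: "(x, x) \<in> r"
    using po less.prems by (auto simp: partial_order_on_def preorder_on_def refl_on_def Field_def)
  show ?case
  proof (cases "x = y")
    case True
    then show ?thesis using rx by (intro exI[of _ "[]"]) auto
  next
    case False
    obtain c where c: "(x, c) \<in> covering r" "(c, y) \<in> r"
      using covering_above[OF po fin less.prems False] .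
    then have xc: "(x, c) \<in> r" "x \<noteq> c" by (auto simp: covering_def)
    have "finite {w. (x, w) \<in> r}"
      by (rule finite_subset[OF _ fin]) (auto simp: Field_def)
    moreover have "{w. (c, w) \<in> r} \<subset> {w. (x, w) \<in> r}"
      using xc rx tr as by (auto dest: transD antisymD)
    ultimately have "card {w. (c, w) \<in> r} < card {w. (x, w) \<in> r}"
      by (rule psubset_card_mono)
    from less.hyps[OF this c(2)] obtain p where
      p: "pcas c p y" "set p \<subseteq> covering r" "distinct (pawalk_verts c p)"
         "\<forall>v\<in>set (pawalk_verts c p). (c, v) \<in> r \<and> (v, y) \<in> r" by blast
    have "x \<notin> set (pawalk_verts c p)" using p(4) xc as by (auto dest: antisymD)
    then show ?thesis using p c xc less.prems tr rx
      by (intro exI[of _ "(x, c) # p"]) (auto dest: transD)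
  qed
qed

text \<open>
  Counting arcs modulo the length treats the arc that closes the walk like any other. In a cycle, every
  vertex therefore has a predecessor and a successor, wherever the walk starts.
\<close>

lemma cyclic_neighbours:
  assumes p: "pcas u p u" "i < length p"
  shows "fst (p ! (Suc i mod length p)) = snd (p ! i)"
proof -
  have hd: "pcas a q b \<Longrightarrow> q \<noteq> [] \<Longrightarrow> fst (q ! 0) = a" for a q b
    by (cases q) auto
  have step: "pcas a q b \<Longrightarrow> Suc j < length q \<Longrightarrow> fst (q ! Suc j) = snd (q ! j)" for a q b j
  proof (induction q arbitrary: a j)
    case (Cons e q)
    then show ?case by (cases j; cases q) auto
  qed simp
  have lst: "pcas a q b \<Longrightarrow> q \<noteq> [] \<Longrightarrow> snd (q ! (length q - 1)) = b" for a q b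
  proof (induction q arbitrary: a)
    case (Cons e q)
    then show ?case by (cases q) auto
  qed simp
  show ?thesis
  proof (cases "Suc i < length p")
    case True
    then show ?thesis using step[OF p(1) True] by simp
  next
    case False
    then have "Suc i = length p" "p \<noteq> []" using p(2) by auto
    then show ?thesis using hd[OF p(1)] lst[OF p(1)] by (metis diff_Suc_1 mod_self)
  qed
qed

text \<open>
  Connectedness holds because saturated chains lead from every element to the greatest one. If \<open>x\<close> has
  two upper covers \<open>y\<close> and \<open>z\<close>, then saturated chains from \<open>y\<close> and \<open>z\<close> to a minimal common upper bound
  close up to a cycle through \<open>x\<close>. Conversely, the two neighbours of a minimal vertex of a cycle are
  both upper covers of that vertex. Finally, upper covers are unique exactly if principal filters are
  chains.
\<close>

theorem undirected_tree_hasse_diagram_iff: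
  assumes po: "partial_order_on (Field r) r" and fin: "finite (Field r)"
    and top: "t \<in> Field r" "\<And>x. x \<in> Field r \<Longrightarrow> (x, t) \<in> r"
  shows "undirected_tree (with_proj (hasse_diagram r)) \<longleftrightarrow>
    (\<forall>x y z. (x, y) \<in> r \<and> (x, z) \<in> r \<longrightarrow> (y, z) \<in> r \<or> (z, y) \<in> r)"
    (is "?tree \<longleftrightarrow> ?chains")
proof -
  have tr: "trans r" and as: "antisym r" and rf: "\<And>x. x \<in> Field r \<Longrightarrow> (x, x) \<in> r"
    using po by (auto simp: partial_order_on_def preorder_on_def refl_on_def)
  let ?H = "with_proj (hasse_diagram r)"
  have cov_r: "(x, y) \<in> covering r \<Longrightarrow> (x, y) \<in> r \<and> x \<noteq> y" for x y
    by (auto simp: covering_def)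
  have cov_F: "(x, y) \<in> covering r \<Longrightarrow> x \<in> Field r \<and> y \<in> Field r" for x y
    by (auto simp: covering_def intro: FieldI1 FieldI2)
  interpret H: pair_wf_digraph "hasse_diagram r"
    by unfold_locales (auto simp: hasse_diagram_def dest: cov_F)
  interpret S: pair_wf_digraph "mk_symmetric ?H"
    by (rule H.wellformed_mk_symmetric)
  interpret S: pair_sym_digraph "mk_symmetric ?H"
    by unfold_locales (rule symmetric_mk_symmetric)
  have pverts: "pverts (hasse_diagram r) = Field r"
    by (simp add: hasse_diagram_def)
  have parcs: "parcs (mk_symmetric ?H) = covering r \<union> (covering r)\<inverse>"
    by (auto simp: parcs_mk_symmetric hasse_diagram_def)
  have conn: "Digraph_Component.connected ?H"
  proof (rule H.connectedI)
    show "pverts (hasse_diagram r) \<noteq> {}" using top by (auto simp: pverts)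
    have to_top: "x \<rightarrow>\<^sup>*\<^bsub>with_proj (mk_symmetric ?H)\<^esub> t" if x: "x \<in> Field r" for x
    proof -
      obtain p where "pcas x p t" "set p \<subseteq> covering r"
        using saturated_chain[OF po fin top(2)[OF x]] by blast
      then have "S.awalk x p t"
        using x by (auto simp: S.awalk_def pverts parcs)
      then show ?thesis by (rule S.reachable_awalkI)
    qed
    fix u v assume "u \<in> pverts (hasse_diagram r)" "v \<in> pverts (hasse_diagram r)"
    then have "u \<in> Field r" "v \<in> Field r" by (auto simp: hasse_diagram_def)
    then show "u \<rightarrow>\<^sup>*\<^bsub>with_proj (mk_symmetric ?H)\<^esub> v"
      using S.reachable_trans[OF to_top] symmetric_reachable[OF symmetric_mk_symmetric to_top] by blast
  qed
  have "?tree \<longleftrightarrow> \<not> (\<exists>p. S.cycle p \<and> 3 \<le> length p)"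
    using conn by (simp add: undirected_tree_def)
  also have "\<dots> \<longleftrightarrow> (\<forall>x y z. (x, y) \<in> covering r \<and> (x, z) \<in> covering r \<longrightarrow> y = z)"
  proof
    assume acyc: "\<not> (\<exists>p. S.cycle p \<and> 3 \<le> length p)"
    show "\<forall>x y z. (x, y) \<in> covering r \<and> (x, z) \<in> covering r \<longrightarrow> y = z"
    proof (rule ccontr)
      assume "\<not> ?thesis"
      then obtain x y z where xyz: "(x, y) \<in> covering r" "(x, z) \<in> covering r" "y \<noteq> z" by blast
      have incomp: "(y, z) \<notin> r" "(z, y) \<notin> r"
        using xyz unfolding covering_def by blast+
      have inF: "x \<in> Field r" "y \<in> Field r" "z \<in> Field r"
        using xyz by (auto dest: cov_F)
      define U where "U = {w. (y, w) \<in> r \<and> (z, w) \<in> r}"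
      have "t \<in> U" using top inF by (auto simp: U_def)
      define below where "below w = {v. (v, w) \<in> r}" for w
      obtain w where w: "w \<in> U" and wmin: "\<And>v. v \<in> U \<Longrightarrow> card (below w) \<le> card (below v)"
        using ex_has_least_nat[of "\<lambda>z. z \<in> U" t "\<lambda>z. card (below z)"] \<open>t \<in> U\<close> by blast
      have wmin': "v = w" if "v \<in> U" "(v, w) \<in> r" for v
      proof (rule ccontr)
        assume "v \<noteq> w"
        have "below v \<subset> below w"
          using that \<open>v \<noteq> w\<close> rf tr as by (auto simp: below_def Field_def dest: transD antisymD)
        moreover have "finite (below w)"
          by (rule finite_subset[OF _ fin]) (auto simp: below_def Field_def)
        ultimately show False using wmin[OF that(1)] psubset_card_mono by (metis leD)
      qed
      obtain p where p: "pcas y p w" "set p \<subseteq> covering r" "distinct (pawalk_verts y p)"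
          "\<forall>v\<in>set (pawalk_verts y p). (y, v) \<in> r \<and> (v, w) \<in> r"
        using saturated_chain[OF po fin, of y w] w by (auto simp: U_def)
      obtain q where q: "pcas z q w" "set q \<subseteq> covering r" "distinct (pawalk_verts z q)"
          "\<forall>v\<in>set (pawalk_verts z q). (z, v) \<in> r \<and> (v, w) \<in> r"
        using saturated_chain[OF po fin, of z w] w by (auto simp: U_def)
      have ne: "p \<noteq> []" "q \<noteq> []" using p(1) q(1) w incomp by (auto simp: U_def)
      have wp: "S.awalk y p w" and wq: "S.awalk z q w"
        using p q inF by (auto simp: S.awalk_def pverts parcs)
      \<comment> \<open>Up along \<open>p\<close> to \<open>w\<close>, down along \<open>q\<close>, and back to \<open>x\<close>.\<close>
      let ?c = "(x, y) # p @ rev_path q @ [(z, x)]"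
      have wq': "S.awalk w (rev_path q) z" using wq by simp
      have vq: "pawalk_verts w (rev_path q) = rev (pawalk_verts z q)"
        using S.awalk_verts_rev_path[OF wq] .
      have "S.awalk z [(z, x)] x" using xyz inF by (simp add: S.awalk_def pverts parcs)
      then have "S.awalk y (p @ rev_path q @ [(z, x)]) x"
        using wp wq' by (intro S.awalk_appendI)
      moreover have "(x, y) \<in> parcs (mk_symmetric ?H)" using xyz by (simp add: parcs)
      ultimately have "S.awalk x ?c x"
        by (simp only: S.awalk_Cons_iff fst_conv snd_conv simp_thms)
      moreover have "distinct (tl (pawalk_verts x ?c))"
      proof -
        have vp: "pawalk_verts y p = map fst p @ [w]"
          using ne wp S.awalk_verts_conv[of y p] by (metis S.awlast_of_awalk S.awalkE' snoc_eq_iff_butlast last_snoc)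
        have "map fst (rev_path q) @ [z] = rev (pawalk_verts z q)"
          using ne wq' S.awalk_verts_conv[of w "rev_path q"] vq
          by (metis S.awalkE' last_snoc rev_path_empty)
        then have "tl (pawalk_verts x ?c) = map fst p @ rev (pawalk_verts z q) @ [x]"
          using S.awalk_verts_conv[of y "p @ rev_path q @ [(z, x)]"] by simp
        moreover have "set (map fst p) \<inter> set (pawalk_verts z q) = {}"
        proof safe
          fix v assume v: "v \<in> set (map fst p)" "v \<in> set (pawalk_verts z q)"
          then have "v \<in> U" "(v, w) \<in> r" using p(4) q(4) vp by (auto simp: U_def)
          then have "v = w" by (rule wmin')
          then show "v \<in> {}" using v(1) p(3) vp by simp
        qed
        moreover have "x \<notin> set (map fst p)" "x \<notin> set (pawalk_verts z q)"
          using p(4) q(4) vp cov_r[OF xyz(1)] cov_r[OF xyz(2)] as by (auto dest: antisymD)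
        ultimately show ?thesis using p(3) q(3) vp by auto
      qed
      moreover have "3 \<le> length ?c" using ne by (cases p) auto
      ultimately show False using acyc S.cycle_def by blast
    qed
  next
    assume uniq: "\<forall>x y z. (x, y) \<in> covering r \<and> (x, z) \<in> covering r \<longrightarrow> y = z"
    show "\<not> (\<exists>p. S.cycle p \<and> 3 \<le> length p)"
    proof safe
      fix p assume cyc: "S.cycle p" and len: "3 \<le> length p"
      then obtain u where u: "S.awalk u p u" "distinct (tl (pawalk_verts u p))"
        by (auto simp: S.cycle_def)
      then have cas: "pcas u p u" and arcs: "set p \<subseteq> covering r \<union> (covering r)\<inverse>"
        by (auto simp: S.awalk_def parcs)
      have dist: "distinct (map snd p)"
        using u(2) S.awalk_verts_conv'[of u p u] cas len by (auto split: if_splits)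
      define below where "below w = {v. (v, w) \<in> r}" for w
      have "0 < length p" using len by linarith
      then have "\<exists>i<length p. \<forall>j<length p. card (below (snd (p ! i))) \<le> card (below (snd (p ! j)))"
        by (rule ex_has_least_nat)
      then obtain i where i: "i < length p"
        and min: "\<And>j. j < length p \<Longrightarrow> card (below (snd (p ! i))) \<le> card (below (snd (p ! j)))" by blast
      have min': "(snd (p ! j), snd (p ! i)) \<notin> covering r" if "j < length p" for j
      proof
        assume "(snd (p ! j), snd (p ! i)) \<in> covering r"
        then have *: "(snd (p ! j), snd (p ! i)) \<in> r" "snd (p ! j) \<noteq> snd (p ! i)" by (auto dest: cov_r)
        then have "below (snd (p ! j)) \<subset> below (snd (p ! i))"
          using rf tr as by (auto simp: below_def Field_def dest: transD antisymD)
        moreover have "finite (below (snd (p ! i)))"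
          by (rule finite_subset[OF _ fin]) (auto simp: below_def Field_def)
        ultimately show False using min[OF that] psubset_card_mono by (metis leD)
      qed
      let ?n = "length p"
      \<comment> \<open>The neighbours of the minimal vertex, which is the head of arc \<open>i\<close>, are the heads of the arcs \<open>h\<close> and \<open>j\<close>.\<close>
      define h where "h = (if i = 0 then ?n - 1 else i - 1)"
      define j where "j = Suc i mod ?n"
      have j': "j = (if Suc i = ?n then 0 else Suc i)" using i by (simp add: j_def)
      obtain l where l: "?n = Suc l" using len by (cases "?n") auto
      have h: "h < ?n" "Suc h mod ?n = i" using i by (auto simp: h_def l)
      have j: "j < ?n" "h \<noteq> j" using i len by (auto simp: h_def j' l)
      have "fst (p ! i) = snd (p ! h)" using cyclic_neighbours[OF cas h(1)] h(2) by simp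
      then have "(snd (p ! i), snd (p ! h)) \<in> covering r"
        using min'[OF h(1)] arcs nth_mem[OF i] by (metis UnE converseD prod.collapse subsetD)
      moreover have "fst (p ! j) = snd (p ! i)" using cyclic_neighbours[OF cas i] by (simp add: j_def)
      then have "(snd (p ! i), snd (p ! j)) \<in> covering r"
        using min'[OF j(1)] arcs nth_mem[OF j(1)] by (metis UnE converseD prod.collapse subsetD)
      ultimately have "snd (p ! h) = snd (p ! j)" using uniq by blast
      then show False using dist h(1) j by (auto simp: distinct_conv_nth)
    qed
  qed
  also have "\<dots> \<longleftrightarrow> ?chains"
  proof
    assume uniq: "\<forall>x y z. (x, y) \<in> covering r \<and> (x, z) \<in> covering r \<longrightarrow> y = z"
    have "(y, z) \<in> r \<or> (z, y) \<in> r" if "(x, y) \<in> r" "(x, z) \<in> r" for x y z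
      using that
    proof (induction "card {w. (x, w) \<in> r}" arbitrary: x rule: less_induct)
      case less
      show ?case
      proof (cases "x = y \<or> x = z")
        case True
        then show ?thesis using less.prems by auto
      next
        case False
        then obtain c where c: "(x, c) \<in> covering r" "(c, y) \<in> r" "(c, z) \<in> r"
          using covering_above[OF po fin less.prems(1)] covering_above[OF po fin less.prems(2)] uniq by metis
        have "finite {w. (x, w) \<in> r}"
          by (rule finite_subset[OF _ fin]) (auto simp: Field_def)
        moreover have "{w. (c, w) \<in> r} \<subset> {w. (x, w) \<in> r}"
          using cov_r[OF c(1)] rf tr as by (auto simp: Field_def dest: transD antisymD)
        ultimately have "card {w. (c, w) \<in> r} < card {w. (x, w) \<in> r}"
          by (rule psubset_card_mono)
        then show ?thesis using less.hyps c by blast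
      qed
    qed
    then show ?chains by blast
  next
    assume ?chains
    then show "\<forall>x y z. (x, y) \<in> covering r \<and> (x, z) \<in> covering r \<longrightarrow> y = z"
      unfolding covering_def by blast
  qed
  finally show ?thesis .
qed


section \<open>Intervals of words\<close>

definition gapless :: "nat set \<Rightarrow> bool" where
  "gapless X \<longleftrightarrow> (\<forall>x\<in>X. \<forall>z\<in>X. \<forall>y. x \<le> y \<and> y \<le> z \<longrightarrow> y \<in> X)"

lemma gaplessD: "gapless X \<Longrightarrow> x \<in> X \<Longrightarrow> z \<in> X \<Longrightarrow> x \<le> y \<Longrightarrow> y \<le> z \<Longrightarrow> y \<in> X"
  unfolding gapless_def by blast

lemma gapless_atLeastLessThan: "gapless {a..<b}"
  by (auto simp: gapless_def)

lemma gapless_eq_atLeastAtMost: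
  assumes "gapless X" "finite X" "X \<noteq> {}"
  shows "X = {Min X..Max X}"
proof
  show "X \<subseteq> {Min X..Max X}" using assms by auto
  show "{Min X..Max X} \<subseteq> X"
    using gaplessD[OF assms(1) Min_in[OF assms(2,3)] Max_in[OF assms(2,3)]] by auto
qed

primrec before :: "'a list \<Rightarrow> 'a \<Rightarrow> 'a \<Rightarrow> bool" where
  "before [] x y \<longleftrightarrow> False"
| "before (a # w) x y \<longleftrightarrow> x = a \<and> y \<in> set w \<or> before w x y"

lemma before_in_set: "before w x y \<Longrightarrow> x \<in> set w \<and> y \<in> set w"
  by (induction w) auto

lemma before_append:
  "before (u @ w) x y \<longleftrightarrow> before u x y \<or> before w x y \<or> x \<in> set u \<and> y \<in> set w"
  by (induction u) auto

lemma before_rev: "before (rev w) x y \<longleftrightarrow> before w y x"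
  by (induction w) (auto simp: before_append)

lemma before_asym: "distinct w \<Longrightarrow> before w x y \<Longrightarrow> \<not> before w y x"
proof (induction w)
  case (Cons a w)
  then show ?case using before_in_set[of w x y] before_in_set[of w y x] by auto
qed simp

lemma before_concat_map:
  "before (concat (map b p)) x y \<longleftrightarrow>
    (\<exists>i j. before p i j \<and> x \<in> set (b i) \<and> y \<in> set (b j)) \<or> (\<exists>i\<in>set p. before (b i) x y)"
  by (induction p) (auto simp: before_append)

lemma before_iff_nth:
  "before w x y \<longleftrightarrow> (\<exists>i j. i < j \<and> j < length w \<and> w ! i = x \<and> w ! j = y)"
proof (induction w)
  case (Cons a w)
  have "before (a # w) x y \<longleftrightarrow>
      x = a \<and> (\<exists>j<length w. w ! j = y) \<or> (\<exists>i j. i < j \<and> j < length w \<and> w ! i = x \<and> w ! j = y)"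
    by (simp add: Cons.IH in_set_conv_nth)
  also have "\<dots> \<longleftrightarrow> (\<exists>i j. i < j \<and> j < length (a # w) \<and> (a # w) ! i = x \<and> (a # w) ! j = y)"
    (is "?L \<longleftrightarrow> ?R")
  proof
    assume ?L
    then show ?R
    proof (elim disjE exE conjE)
      fix j assume "x = a" "j < length w" "w ! j = y"
      then show ?R by (intro exI[of _ 0] exI[of _ "Suc j"]) auto
    next
      fix i j assume "i < j" "j < length w" "w ! i = x" "w ! j = y"
      then show ?R by (intro exI[of _ "Suc i"] exI[of _ "Suc j"]) auto
    qed
  next
    assume ?R
    then obtain i j where ij: "i < j" "j < length (a # w)" "(a # w) ! i = x" "(a # w) ! j = y" by blast
    then obtain j' where "j = Suc j'" by (cases j) auto
    with ij show ?L by (cases i) auto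
  qed
  finally show ?case .
qed simp

text \<open>
  For a word without repetitions these are the sets of letters in consecutive positions. Phrased in terms
  of the order of occurrence alone, the notion can be followed through a concatenation without any
  arithmetic on positions.
\<close>

definition contiguous :: "'a list \<Rightarrow> 'a set \<Rightarrow> bool" where
  "contiguous w X \<longleftrightarrow> X \<subseteq> set w \<and> (\<forall>x\<in>X. \<forall>z\<in>X. \<forall>y. before w x y \<and> before w y z \<longrightarrow> y \<in> X)"

lemma contiguousD:
  "contiguous w X \<Longrightarrow> before w x y \<Longrightarrow> before w y z \<Longrightarrow> x \<in> X \<Longrightarrow> z \<in> X \<Longrightarrow> y \<in> X"
  unfolding contiguous_def by blast

definition word_intervals :: "nat list \<Rightarrow> nat set set" where
  "word_intervals w = {X. X \<noteq> {} \<and> gapless X \<and> contiguous w X}"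

lemma word_intervals_subset: "X \<in> word_intervals w \<Longrightarrow> X \<subseteq> set w"
  unfolding word_intervals_def contiguous_def by blast

lemma word_intervals_nonempty: "X \<in> word_intervals w \<Longrightarrow> X \<noteq> {}"
  unfolding word_intervals_def by blast

lemma word_intervals_rev: "word_intervals (rev w) = word_intervals w"
  by (auto simp: word_intervals_def contiguous_def before_rev)

text \<open>
  A word without repetitions is a direct sum of two nonempty words if some final segment of it consists of
  its largest letters, with at least one letter left over. The letters of such a segment form a set \<open>Y\<close>
  that is closed upwards both in value and in position.
\<close>

definition sum_indecomposable :: "nat list \<Rightarrow> bool" where
  "sum_indecomposable w \<longleftrightarrow> (\<forall>Y. Y \<noteq> {} \<and> Y \<subseteq> set w \<and> (\<forall>y\<in>Y. \<forall>z\<in>set w. y \<le> z \<longrightarrow> z \<in> Y)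
     \<and> (\<forall>y\<in>Y. \<forall>z. before w y z \<longrightarrow> z \<in> Y) \<longrightarrow> Y = set w)"

lemma sum_indecomposableD:
  assumes "sum_indecomposable w" "y \<in> Y" "Y \<subseteq> set w"
    "\<And>y z. y \<in> Y \<Longrightarrow> z \<in> set w \<Longrightarrow> y \<le> z \<Longrightarrow> z \<in> Y"
    "\<And>y z. y \<in> Y \<Longrightarrow> before w y z \<Longrightarrow> z \<in> Y"
  shows "Y = set w"
proof (rule assms(1)[unfolded sum_indecomposable_def, THEN spec, THEN mp], intro conjI ballI allI impI)
  show "Y \<noteq> {}" using assms(2) by auto
qed (use assms(3-) in blast)+


section \<open>Inflations\<close>

text \<open>
  The word \<open>p\<close> arranges the letters \<open>0, \<dots>, k - 1\<close>, and the letter \<open>i\<close> is replaced by the word \<open>b i\<close>.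
  The block of index \<open>i\<close>, the letters of \<open>b i\<close>, ends in value where the next one begins, so the blocks follow each other in
  value in the order of their indices and in position in the order given by \<open>p\<close>.
\<close>

locale inflation =
  fixes k :: nat and c :: "nat \<Rightarrow> nat" and b :: "nat \<Rightarrow> nat list" and p :: "nat list"
  assumes c_less: "i < k \<Longrightarrow> c i < c (Suc i)"
    and set_b: "i < k \<Longrightarrow> set (b i) = {c i..<c (Suc i)}"
    and distinct_b: "i < k \<Longrightarrow> distinct (b i)"
    and distinct_p: "distinct p"
    and set_p: "set p = {..<k}"
begin

definition inflated :: "nat list" where "inflated = concat (map b p)"

definition block :: "nat \<Rightarrow> nat set" where "block i = {c i..<c (Suc i)}"

lemma set_block: "i < k \<Longrightarrow> set (b i) = block i"
  by (simp add: block_def set_b)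

lemma start_in_block: "i < k \<Longrightarrow> c i \<in> block i"
  using c_less by (simp add: block_def)

lemma c_mono: "i \<le> j \<Longrightarrow> j \<le> k \<Longrightarrow> c i \<le> c j"
proof (induction j rule: dec_induct)
  case (step n)
  then show ?case using c_less[of n] by simp
qed simp

lemma block_less: "i < j \<Longrightarrow> j < k \<Longrightarrow> x \<in> block i \<Longrightarrow> y \<in> block j \<Longrightarrow> x < y"
  using c_mono[of "Suc i" j] by (auto simp: block_def)

lemma block_unique: "i < k \<Longrightarrow> j < k \<Longrightarrow> x \<in> block i \<Longrightarrow> x \<in> block j \<Longrightarrow> i = j"
  using block_less[of i j x x] block_less[of j i x x] by (cases i j rule: linorder_cases) auto

lemma UN_block: "m \<le> k \<Longrightarrow> (\<Union>i<m. block i) = {c 0..<c m}"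
proof (induction m)
  case (Suc m)
  then show ?case using c_mono[of 0 m] c_less[of m] by (auto simp: lessThan_Suc block_def)
qed simp

lemma set_inflated: "set inflated = {c 0..<c k}"
  using UN_block[of k] set_block by (auto simp: inflated_def set_p)

lemma in_set_inflated: "x \<in> set inflated \<longleftrightarrow> (\<exists>i<k. x \<in> block i)"
  using UN_block[of k] unfolding set_inflated by blast

lemma distinct_inflated: "distinct inflated"
  unfolding inflated_def
proof (rule distinct_concat)
  have "inj_on b {..<k}"
  proof (rule inj_onI)
    fix i j assume "i \<in> {..<k}" "j \<in> {..<k}" "b i = b j"
    then show "i = j" using set_block[of i] set_block[of j] start_in_block[of i] block_unique[of i j "c i"] by auto
  qed
  then show "distinct (map b p)" by (simp add: distinct_map distinct_p set_p)
  show "distinct ys" if "ys \<in> set (map b p)" for ys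
    using that distinct_b by (auto simp: set_p)
  show "set ys \<inter> set zs = {}" if yz: "ys \<in> set (map b p)" "zs \<in> set (map b p)" "ys \<noteq> zs" for ys zs
  proof -
    obtain i where i: "i < k" "ys = b i" using yz(1) by (auto simp: set_p)
    obtain j where j: "j < k" "zs = b j" using yz(2) by (auto simp: set_p)
    have "i \<noteq> j" using yz(3) i j by auto
    then show ?thesis using i j set_block block_unique[of i j] by blast
  qed
qed

lemma before_inflated:
  assumes "i < k" "j < k" "x \<in> block i" "y \<in> block j"
  shows "before inflated x y \<longleftrightarrow> before p i j \<or> i = j \<and> before (b i) x y"
proof
  assume "before inflated x y"
  then consider i' j' where "before p i' j'" "x \<in> set (b i')" "y \<in> set (b j')"
    | i' where "i' < k" "before (b i') x y"
    unfolding inflated_def before_concat_map set_p by blast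
  then show "before p i j \<or> i = j \<and> before (b i) x y"
  proof cases
    case 1
    then have lt: "i' < k" "j' < k" using before_in_set[of p i' j'] by (auto simp: set_p)
    then have "x \<in> block i'" "y \<in> block j'" using 1 set_block by auto
    then have "i' = i" "j' = j"
      using block_unique[OF lt(1) assms(1) _ assms(3)] block_unique[OF lt(2) assms(2) _ assms(4)] by simp_all
    then show ?thesis using 1 by simp
  next
    case 2
    then have "x \<in> block i'" "y \<in> block i'"
      using before_in_set[OF 2(2)] set_block[OF 2(1)] by simp_all
    then have "i' = i" "i' = j"
      using block_unique[OF 2(1) assms(1) _ assms(3)] block_unique[OF 2(1) assms(2) _ assms(4)] by simp_all
    then show ?thesis using 2 by simp
  qed
next
  assume "before p i j \<or> i = j \<and> before (b i) x y"
  then show "before inflated x y"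
  proof
    assume "before p i j"
    then show ?thesis using assms set_block unfolding inflated_def before_concat_map by blast
  next
    assume "i = j \<and> before (b i) x y"
    moreover have "i \<in> set p" using assms(1) by (simp add: set_p)
    ultimately show ?thesis unfolding inflated_def before_concat_map by blast
  qed
qed

text \<open>
  No letter of another block stands between two letters of the same block.
\<close>

lemma block_interval_iff:
  assumes i: "i < k" and X: "X \<subseteq> block i"
  shows "X \<in> word_intervals inflated \<longleftrightarrow> X \<in> word_intervals (b i)"
proof -
  have "contiguous inflated X \<longleftrightarrow> contiguous (b i) X"
  proof
    assume C: "contiguous inflated X"
    show "contiguous (b i) X" unfolding contiguous_def
    proof (intro conjI ballI allI impI)
      show "X \<subseteq> set (b i)" using X set_block[OF i] by simp
      fix x z y assume *: "x \<in> X" "z \<in> X" "before (b i) x y \<and> before (b i) y z"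
      then have "y \<in> block i" using before_in_set[of "b i" x y] set_block[OF i] by auto
      then have "before inflated x y" "before inflated y z" using * X before_inflated[OF i i] by auto
      then show "y \<in> X" using contiguousD[OF C] * by blast
    qed
  next
    assume C: "contiguous (b i) X"
    show "contiguous inflated X" unfolding contiguous_def
    proof (intro conjI ballI allI impI)
      show "X \<subseteq> set inflated" using X i in_set_inflated by blast
      fix x z y assume *: "x \<in> X" "z \<in> X" "before inflated x y \<and> before inflated y z"
      then have "y \<in> set inflated" using before_in_set by fast
      then obtain j where j: "j < k" "y \<in> block j" by (auto simp: in_set_inflated)
      have "before p i j \<or> i = j \<and> before (b i) x y" "before p j i \<or> j = i \<and> before (b j) y z"
        using before_inflated[OF i j(1), of x y] before_inflated[OF j(1) i, of y z] * X j by auto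
      then have "before (b i) x y" "before (b i) y z"
        using before_asym[OF distinct_p, of i j] before_asym[OF distinct_p, of i i] by auto
      then show "y \<in> X" using contiguousD[OF C] * by blast
    qed
  qed
  then show ?thesis by (simp add: word_intervals_def)
qed

lemma full_interval: "k > 0 \<Longrightarrow> {c 0..<c k} \<in> word_intervals inflated"
  using c_less[of 0] c_mono[of 1 k] before_in_set[of inflated] unfolding set_inflated
  by (fastforce simp: word_intervals_def contiguous_def set_inflated gapless_atLeastLessThan)

definition met :: "nat set \<Rightarrow> nat set" where "met X = {i. i < k \<and> X \<inter> block i \<noteq> {}}"

lemma met_cases:
  assumes "X \<subseteq> set inflated" "X \<noteq> {}"
  obtains i where "i < k" "X \<subseteq> block i" | i j where "i \<in> met X" "j \<in> met X" "i \<noteq> j"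
proof -
  obtain x i where x: "x \<in> X" "i < k" "x \<in> block i" using assms in_set_inflated by blast
  show ?thesis
  proof (cases "X \<subseteq> block i")
    case True
    then show ?thesis using that(1) x by blast
  next
    case False
    then obtain y where y: "y \<in> X" "y \<notin> block i" by blast
    then obtain j where j: "j < k" "y \<in> block j" using assms(1) in_set_inflated[of y] by blast
    then have "i \<noteq> j" using y by auto
    then show ?thesis using that(2)[of i j] x y j by (auto simp: met_def)
  qed
qed

lemma value_between_met:
  assumes "gapless X" "i \<in> met X" "j \<in> met X" "i < m" "m < j"
  shows "block m \<subseteq> X"
proof
  fix y assume y: "y \<in> block m"
  obtain x z where "x \<in> X" "x \<in> block i" "z \<in> X" "z \<in> block j" "j < k"
    using assms(2,3) by (auto simp: met_def)
  then show "y \<in> X"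
    using block_less[of i m x y] block_less[of m j y z] y assms gaplessD[of X x z y] by auto
qed

lemma position_between_met:
  assumes "contiguous inflated X" "i \<in> met X" "j \<in> met X" "before p i m" "before p m j"
  shows "block m \<subseteq> X"
proof
  fix y assume y: "y \<in> block m"
  obtain x z where *: "x \<in> X" "x \<in> block i" "i < k" "z \<in> X" "z \<in> block j" "j < k"
    using assms(2,3) by (auto simp: met_def)
  have "m < k" using before_in_set[OF assms(4)] by (simp add: set_p)
  then have "before inflated x y" "before inflated y z" using before_inflated y * assms by blast+
  then show "y \<in> X" using contiguousD[OF assms(1)] * by blast
qed

lemma block_nonempty: "i < k \<Longrightarrow> block i \<noteq> {}"
  using start_in_block by blast

text \<open>
  A block between two blocks met by \<open>X\<close>, in value or in position, is even contained in \<open>X\<close>. So an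
  interval of the inflation projects to an interval of \<open>p\<close>.
\<close>

lemma met_interval:
  assumes "gapless X" "contiguous inflated X"
  shows "gapless (met X)" "contiguous p (met X)"
proof -
  show "gapless (met X)" unfolding gapless_def
  proof (intro ballI allI impI)
    fix i j m assume *: "i \<in> met X" "j \<in> met X" "i \<le> m \<and> m \<le> j"
    show "m \<in> met X"
    proof (cases "m = i \<or> m = j")
      case False
      then have "block m \<subseteq> X" using value_between_met[OF assms(1) *(1,2)] * by simp
      moreover have "m < k" using * by (auto simp: met_def)
      ultimately show ?thesis using block_nonempty[of m] by (simp add: met_def) blast
    qed (use * in auto)
  qed
  show "contiguous p (met X)" unfolding contiguous_def
  proof (intro conjI ballI allI impI)
    show "met X \<subseteq> set p" by (auto simp: met_def set_p)
    fix i j m assume *: "i \<in> met X" "j \<in> met X" "before p i m \<and> before p m j"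
    then have "block m \<subseteq> X" using position_between_met[OF assms(2)] by blast
    moreover have "m < k" using * before_in_set[of p i m] by (auto simp: set_p)
    ultimately show "m \<in> met X" using block_nonempty[of m] by (simp add: met_def) blast
  qed
qed

end

text \<open>
  An interval \<open>X\<close> that meets both blocks consists of letters of \<open>b 0\<close> that are closed upwards in value
  and position, and of letters of \<open>b 1\<close> that are closed downwards. As both words are indecomposable, \<open>X\<close>
  contains all of \<open>b 0\<close> and, looking at the complement, all of \<open>b 1\<close>. The reversal is a skew sum: an
  up-closed nonempty set contains a letter of its first part, which is \<open>b 1\<close> reversed, then all of the
  second part, then the largest values, which are those of \<open>b 1\<close>.
\<close>

lemma word_intervals_direct_sum:
  assumes "inflation 2 c b [0, 1]" and indec: "sum_indecomposable (b 0)" "sum_indecomposable (b 1)"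
  shows "word_intervals (b 0 @ b 1) = insert {c 0..<c 2} (word_intervals (b 0) \<union> word_intervals (b 1))"
    and "sum_indecomposable (rev (b 0 @ b 1))"
proof -
  interpret inflation 2 c b "[0, 1]" by fact
  have inflated: "b 0 @ b 1 = inflated" unfolding inflated_def by simp
  have block: "block 0 = set (b 0)" "block 1 = set (b 1)" using set_block[of 0] set_block[of 1] by auto
  have lt: "c 0 < c 1" "c 1 < c 2" using c_less[of 0] c_less[of 1] by (auto simp: numeral_2_eq_2)
  have set: "set (b 0) = {c 0..<c 1}" "set (b 1) = {c 1..<c 2}"
    using set_b[of 0] set_b[of 1] by (auto simp: numeral_2_eq_2)
  have "X = {c 0..<c 2}" if X: "X \<in> word_intervals inflated" and m: "i \<in> met X" "j \<in> met X" "i \<noteq> j" for X i j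
  proof -
    have g: "gapless X" and co: "contiguous inflated X" using X by (auto simp: word_intervals_def)
    have "0 \<in> met X \<and> 1 \<in> met X"
    proof -
      have "i < 2" "j < 2" using m by (auto simp: met_def)
      then have "i = 0 \<and> j = 1 \<or> i = 1 \<and> j = 0" using m(3) by auto
      then show ?thesis using m by auto
    qed
    then obtain x z where x: "x \<in> X" "x \<in> set (b 0)" and z: "z \<in> X" "z \<in> set (b 1)"
      by (auto simp: met_def block block(2)[unfolded One_nat_def])
    have bw: "before inflated u v \<longleftrightarrow> before (b 0) u v \<or> before (b 1) u v \<or> u \<in> set (b 0) \<and> v \<in> set (b 1)" for u v
      unfolding inflated[symmetric] by (rule before_append)
    have zc: "c 1 \<le> z" and xc: "x < c 1" using x z unfolding set by simp_all
    have "X \<inter> set (b 0) = set (b 0)"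
    proof (rule sum_indecomposableD[OF indec(1)])
      show "x \<in> X \<inter> set (b 0)" using x by simp
      show "v \<in> X \<inter> set (b 0)" if "y \<in> X \<inter> set (b 0)" "v \<in> set (b 0)" "y \<le> v" for y v
        using that z zc gaplessD[OF g, of y z v] by (simp add: set)
      show "v \<in> X \<inter> set (b 0)" if "y \<in> X \<inter> set (b 0)" "before (b 0) y v" for y v
        using that z contiguousD[OF co, of y v z, unfolded bw] before_in_set[of "b 0" y v] by auto
    qed simp
    moreover have "set (b 1) - X = {}"
    proof (rule ccontr)
      assume "set (b 1) - X \<noteq> {}"
      then obtain u where u: "u \<in> set (b 1) - X" by blast
      have "set (b 1) - X = set (b 1)"
      proof (rule sum_indecomposableD[OF indec(2) u])
        show "v \<in> set (b 1) - X" if "y \<in> set (b 1) - X" "v \<in> set (b 1)" "y \<le> v" for y v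
          using that x xc gaplessD[OF g, of x v y] unfolding set by auto
        show "v \<in> set (b 1) - X" if "y \<in> set (b 1) - X" "before (b 1) y v" for y v
          using that x contiguousD[OF co, of x y v, unfolded bw] before_in_set[of "b 1" y v] by auto
      qed auto
      then show False using z by blast
    qed
    ultimately have "set inflated \<subseteq> X" unfolding inflated[symmetric] set_append by blast
    moreover have "X \<subseteq> set inflated" using co unfolding contiguous_def by blast
    ultimately show ?thesis unfolding set_inflated by blast
  qed note full = this
  show "word_intervals (b 0 @ b 1) = insert {c 0..<c 2} (word_intervals (b 0) \<union> word_intervals (b 1))"
    unfolding inflated
  proof (intro equalityI subsetI)
    fix X assume X: "X \<in> word_intervals inflated"
    then have "X \<subseteq> set inflated" "X \<noteq> {}"
      using word_intervals_subset word_intervals_nonempty by blast+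
    then show "X \<in> insert {c 0..<c 2} (word_intervals (b 0) \<union> word_intervals (b 1))"
    proof (cases rule: met_cases)
      case (1 i)
      then have "X \<in> word_intervals (b i)" using block_interval_iff X by blast
      moreover have "i = 0 \<or> i = 1" using 1 by auto
      ultimately show ?thesis by blast
    next
      case (2 i j)
      then show ?thesis using full[OF X] by blast
    qed
  next
    fix X assume "X \<in> insert {c 0..<c 2} (word_intervals (b 0) \<union> word_intervals (b 1))"
    then consider "X = {c 0..<c 2}" | "X \<in> word_intervals (b 0)" | "X \<in> word_intervals (b 1)" by blast
    then show "X \<in> word_intervals inflated"
    proof cases
      case 1
      then show ?thesis using full_interval by simp
    next
      case 2
      then have "X \<subseteq> block 0" unfolding block by (rule word_intervals_subset)
      then show ?thesis using block_interval_iff[of 0 X] 2 by simp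
    next
      case 3
      then have "X \<subseteq> block 1" unfolding block by (rule word_intervals_subset)
      then show ?thesis using block_interval_iff[of 1 X] 3 by simp
    qed
  qed
  show "sum_indecomposable (rev (b 0 @ b 1))"
    unfolding sum_indecomposable_def
  proof (intro allI impI, elim conjE)
    fix Y assume Y: "Y \<noteq> {}" "Y \<subseteq> set (rev (b 0 @ b 1))"
      and val: "\<forall>y\<in>Y. \<forall>z\<in>set (rev (b 0 @ b 1)). y \<le> z \<longrightarrow> z \<in> Y"
      and pos: "\<forall>y\<in>Y. \<forall>z. before (rev (b 0 @ b 1)) y z \<longrightarrow> z \<in> Y"
    have val': "z \<in> Y" if "y \<in> Y" "z \<in> set (b 0) \<union> set (b 1)" "y \<le> z" for y z
      using val[rule_format, of y z] that by auto
    have pos': "z \<in> Y" if "y \<in> Y" "y \<in> set (b 1)" "z \<in> set (b 0)" for y z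
      using pos[rule_format, of y z] that unfolding before_rev before_append by blast
    have ne: "c 1 \<in> set (b 1)" "c 0 \<in> set (b 0)" using lt unfolding set by simp_all
    obtain y where y: "y \<in> Y" using Y by blast
    have Y1: "set (b 1) \<subseteq> Y" if "y' \<in> Y" "y' \<in> set (b 0)" for y'
    proof
      fix z assume "z \<in> set (b 1)"
      then show "z \<in> Y" using val'[OF that(1), of z] that(2) unfolding set by simp
    qed
    have "\<exists>y'\<in>Y. y' \<in> set (b 1)"
      using Y1[OF y] ne y Y(2) by auto
    then have "set (b 0) \<subseteq> Y" using pos' by blast
    then have "set (b 1) \<subseteq> Y" using Y1 ne by blast
    then show "Y = set (rev (b 0 @ b 1))" using \<open>set (b 0) \<subseteq> Y\<close> Y(2) by auto
  qed
qed


section \<open>Inflations of simple permutations\<close>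

text \<open>
  The odd letters followed by the even ones, for instance \<open>1 3 0 2\<close>. For odd \<open>k\<close> the largest letter
  \<open>k - 1\<close> would come last and leave an interval of size \<open>k - 1\<close> in front of it; it is moved next to \<open>0\<close>,
  as in \<open>1 3 0 4 2\<close>.
\<close>

definition simple_arrangement :: "nat \<Rightarrow> nat list" where
  "simple_arrangement k = map (\<lambda>i. 2 * i + 1) [0..<k div 2] @ 0 # (if odd k then [k - 1] else [])
     @ map (\<lambda>i. 2 * i) [1..<k div 2]"

lemma set_simple_arrangement:
  assumes "k \<ge> 4" shows "set (simple_arrangement k) = {..<k}" "distinct (simple_arrangement k)"
proof -
  have "x \<in> set (simple_arrangement k)" if "x < k" for x
  proof (cases "odd x")
    case True
    then obtain i where "x = 2 * i + 1" by (elim oddE)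
    moreover from this have "i < k div 2" using that by auto
    ultimately show ?thesis by (auto simp: simple_arrangement_def)
  next
    case False
    then obtain i where i: "x = 2 * i" by (metis evenE)
    show ?thesis
    proof (cases "i = 0 \<or> i \<ge> k div 2")
      case True
      then have "x = 0 \<or> odd k \<and> x = k - 1" using that i by (auto elim!: oddE evenE)
      then show ?thesis by (auto simp: simple_arrangement_def)
    next
      case False
      then show ?thesis using i by (auto simp: simple_arrangement_def)
    qed
  qed
  moreover have "set (simple_arrangement k) \<subseteq> {..<k}"
    using assms by (auto simp: simple_arrangement_def)
  ultimately show "set (simple_arrangement k) = {..<k}" by auto
  have "set (map (\<lambda>i. 2 * i + 1) [0..<k div 2]) \<subseteq> {x. odd x}"
    by auto
  moreover have "set (0 # (if odd k then [k - 1] else []) @ map (\<lambda>i. 2 * i) [1..<k div 2]) \<subseteq> {x. even x}"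
    by auto
  ultimately have "set (map (\<lambda>i. 2 * i + 1) [0..<k div 2]) \<inter>
      set (0 # (if odd k then [k - 1] else []) @ map (\<lambda>i. 2 * i) [1..<k div 2]) = {}"
    by blast
  moreover have "distinct (0 # (if odd k then [k - 1] else []) @ map (\<lambda>i. 2 * i) [1..<k div 2])"
    using assms by (auto simp: distinct_map inj_on_def)
  ultimately show "distinct (simple_arrangement k)"
    by (simp only: simple_arrangement_def distinct_append) (simp add: distinct_map inj_on_def)
qed

lemma before_simple_arrangement:
  assumes "k \<ge> 4"
  shows "odd x \<Longrightarrow> x < 2 * (k div 2) - 1 \<Longrightarrow> before (simple_arrangement k) x (2 * (k div 2) - 1)"
    and "odd x \<Longrightarrow> x < k \<Longrightarrow> before (simple_arrangement k) x 0"
    and "even y \<Longrightarrow> 0 < y \<Longrightarrow> y < k \<Longrightarrow> before (simple_arrangement k) 0 y"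
    and "odd x \<Longrightarrow> x < k \<Longrightarrow> even y \<Longrightarrow> y < k \<Longrightarrow> before (simple_arrangement k) x y"
    and "odd k \<Longrightarrow> even y \<Longrightarrow> 0 < y \<Longrightarrow> y < k - 1 \<Longrightarrow> before (simple_arrangement k) (k - 1) y"
proof -
  let ?E = "map (\<lambda>i. 2 * i + 1) [0..<k div 2]"
  let ?O = "map (\<lambda>i. 2 * i) [1..<k div 2]"
  have E: "odd x \<Longrightarrow> x < k \<Longrightarrow> x \<in> set ?E" for x
    by (elim oddE) auto
  have O: "even y \<Longrightarrow> 0 < y \<Longrightarrow> y < 2 * (k div 2) \<Longrightarrow> y \<in> set ?O" for y
    by (elim evenE) auto
  have O': "even y \<Longrightarrow> 0 < y \<Longrightarrow> y < k \<Longrightarrow> y \<in> set ?O \<or> odd k \<and> y = k - 1" for y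
    using O[of y] by (cases "y < 2 * (k div 2)") (auto elim!: oddE evenE)
  show "before (simple_arrangement k) x (2 * (k div 2) - 1)" if x: "odd x" "x < 2 * (k div 2) - 1"
  proof -
    obtain i where i: "x = 2 * i + 1" using x(1) by (elim oddE)
    obtain m where m: "k div 2 = Suc m" using assms by (cases "k div 2") auto
    have "?E = map (\<lambda>i. 2 * i + 1) [0..<m] @ [2 * (k div 2) - 1]"
      by (simp add: m)
    moreover have "x \<in> set (map (\<lambda>i. 2 * i + 1) [0..<m])" using i x(2) m by auto
    ultimately show ?thesis by (simp add: simple_arrangement_def before_append)
  qed
  show "before (simple_arrangement k) x 0" if "odd x" "x < k"
    using E[OF that] by (simp add: simple_arrangement_def before_append)
  show "before (simple_arrangement k) 0 y" if "even y" "0 < y" "y < k"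
    using O'[OF that] by (auto simp add: simple_arrangement_def before_append)
  show "before (simple_arrangement k) x y" if "odd x" "x < k" "even y" "y < k"
    using E[OF that(1,2)] O'[of y] that by (cases "y = 0") (auto simp add: simple_arrangement_def before_append)
  show "before (simple_arrangement k) (k - 1) y" if "odd k" "even y" "0 < y" "y < k - 1"
  proof -
    have "y < 2 * (k div 2)" using that by (auto elim!: oddE)
    then show ?thesis using O[of y] that by (auto simp add: simple_arrangement_def before_append)
  qed
qed

text \<open>
  An interval \<open>K\<close> with at least two letters contains two consecutive values, hence an odd and an even
  letter. All odd letters precede all even ones, so between these two stand the last odd letter \<open>M\<close> and
  the first even letter \<open>0\<close>. Thus \<open>K\<close> contains all values up to \<open>M\<close>. The only value that may be missing
  is \<open>k - 1\<close> for odd \<open>k\<close>, and this letter stands between \<open>1\<close> and \<open>2\<close>.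
\<close>

lemma simple_arrangement_simple:
  assumes k: "k \<ge> 4" and K: "gapless K" "contiguous (simple_arrangement k) K"
    and ij: "i \<in> K" "j \<in> K" "i \<noteq> j"
  shows "K = {..<k}"
proof -
  let ?p = "simple_arrangement k"
  let ?M = "2 * (k div 2) - 1"
  note bef = before_simple_arrangement[OF k]
  have sub: "K \<subseteq> {..<k}" using K(2) set_simple_arrangement[OF k] by (simp add: contiguous_def)
  have "min i j \<in> K" "Suc (min i j) \<in> K"
    using ij gaplessD[OF K(1), of "min i j" "max i j" "Suc (min i j)"] by (auto simp: min_def max_def)
  then obtain x y where x: "x \<in> K" "odd x" and y: "y \<in> K" "even y"
    by (metis even_Suc)
  have xy: "x < k" "y < k" using x y sub by auto
  have "2 \<le> k div 2" using div_le_mono[OF k, of 2] by simp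
  then have M: "odd ?M" "?M < k" "3 \<le> ?M" by (auto elim!: oddE evenE)
  have "?M \<in> K"
  proof (cases "x = ?M")
    case False
    then have "x < ?M" using xy(1) x(2) by presburger
    then show ?thesis using bef(1)[OF x(2)] bef(4)[OF M(1,2) y(2) xy(2)] contiguousD[OF K(2)] x y by blast
  qed (use x in simp)
  have "0 \<in> K"
  proof (cases "y = 0")
    case False
    then show ?thesis using bef(2)[OF x(2) xy(1)] bef(3)[OF y(2) _ xy(2)] contiguousD[OF K(2)] x y by blast
  qed (use y in simp)
  have low: "v \<in> K" if "v \<le> ?M" for v
    using gaplessD[OF K(1) \<open>0 \<in> K\<close> \<open>?M \<in> K\<close>] that by simp
  have "v \<in> K" if "v < k" for v
  proof (cases "v \<le> ?M")
    case True
    then show ?thesis by (rule low)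
  next
    case False
    then have v: "odd k" "v = k - 1" using that k by (auto elim!: oddE evenE)
    have "before ?p 1 (k - 1)" using bef(4)[of 1 "k - 1"] v k by auto
    moreover have "before ?p (k - 1) 2" using bef(5)[of 2] v k by auto
    ultimately show ?thesis using contiguousD[OF K(2)] low[of 1] low[of 2] M v by auto
  qed
  then show ?thesis using sub by auto
qed

text \<open>
  The smallest and the largest letter are the only ones that do not lie between two others in value. They
  lie between two others in position instead. This is why an interval of an inflation that meets all
  blocks contains all of them.
\<close>

lemma simple_arrangement_corners:
  assumes k: "k \<ge> 4" and v: "v = 0 \<or> v = k - 1"
  shows "\<exists>x y. before (simple_arrangement k) x v \<and> before (simple_arrangement k) v y"
proof -
  note bef = before_simple_arrangement[OF k]
  consider "v = 0" | "v = k - 1" "even k" | "v = k - 1" "odd k" using v by blast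
  then show ?thesis
  proof cases
    case 1
    then show ?thesis using bef(2)[of 1] bef(3)[of 2] k by auto
  next
    case 2
    then have "before (simple_arrangement k) 1 v" using bef(1)[of 1] k by auto
    then show ?thesis using bef(2)[of v] 2 k by auto
  next
    case 3
    have "before (simple_arrangement k) v 2" using bef(5)[of 2] k 3 by simp
    moreover have "before (simple_arrangement k) 1 v" using bef(4)[of 1 v] k 3 by simp
    ultimately show ?thesis by blast
  qed
qed

text \<open>
  An interval that meets two blocks meets all, by simplicity, and then contains each of them, since each
  lies between two others in value or in position. Indecomposability follows from this: a nonempty set
  closed upwards in value and position contains the largest value, hence also a letter of a block
  further to the right, so it is an interval meeting two blocks.
\<close>

lemma word_intervals_simple_inflation:
  assumes "inflation k c b (simple_arrangement k)" and k: "k \<ge> 4"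
  shows "word_intervals (concat (map b (simple_arrangement k))) =
      insert {c 0..<c k} (\<Union>i<k. word_intervals (b i))"
    and "sum_indecomposable (concat (map b (simple_arrangement k)))"
proof -
  interpret inflation k c b "simple_arrangement k" by fact
  have inflated: "concat (map b (simple_arrangement k)) = inflated" by (simp add: inflated_def)
  have full: "X = {c 0..<c k}" if X: "gapless X" "contiguous inflated X"
    and m: "i \<in> met X" "j \<in> met X" "i \<noteq> j" for X i j
  proof -
    have met: "met X = {..<k}"
      using simple_arrangement_simple[OF k met_interval[OF X] m] .
    have "block m \<subseteq> X" if "m < k" for m
    proof (cases "m = 0 \<or> m = k - 1")
      case True
      then obtain x y where xy: "before (simple_arrangement k) x m" "before (simple_arrangement k) m y"
        using simple_arrangement_corners[OF k] by blast
      then have "x \<in> met X" "y \<in> met X" using before_in_set[OF xy(1)] before_in_set[OF xy(2)] by (simp_all add: met set_p)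
      then show ?thesis by (rule position_between_met[OF X(2) _ _ xy])
    next
      case False
      then have "0 < m" "m < k - 1" using that by auto
      moreover have "0 \<in> met X" "k - 1 \<in> met X" using k by (auto simp: met)
      ultimately show ?thesis using value_between_met[OF X(1)] by blast
    qed
    then have "set inflated \<subseteq> X" using in_set_inflated by blast
    then show ?thesis using X(2) set_inflated by (auto simp: contiguous_def)
  qed
  show "word_intervals (concat (map b (simple_arrangement k))) =
      insert {c 0..<c k} (\<Union>i<k. word_intervals (b i))"
    unfolding inflated
  proof (intro equalityI subsetI)
    fix X assume X: "X \<in> word_intervals inflated"
    then have "X \<subseteq> set inflated" "X \<noteq> {}"
      using word_intervals_subset word_intervals_nonempty by blast+
    then show "X \<in> insert {c 0..<c k} (\<Union>i<k. word_intervals (b i))"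
    proof (cases rule: met_cases)
      case (1 i)
      then show ?thesis using block_interval_iff X by auto
    next
      case (2 i j)
      then show ?thesis using full X by (simp add: word_intervals_def)
    qed
  next
    fix X assume "X \<in> insert {c 0..<c k} (\<Union>i<k. word_intervals (b i))"
    then consider "X = {c 0..<c k}" | i where "i < k" "X \<in> word_intervals (b i)" by blast
    then show "X \<in> word_intervals inflated"
    proof cases
      case 2
      then have "X \<subseteq> block i" using word_intervals_subset set_block by blast
      then show ?thesis using block_interval_iff 2 by simp
    qed (use full_interval k in simp)
  qed
  show "sum_indecomposable (concat (map b (simple_arrangement k)))"
    unfolding inflated sum_indecomposable_def
  proof (intro allI impI, elim conjE)
    fix Y assume Y: "Y \<noteq> {}" "Y \<subseteq> set inflated"
      and val: "\<forall>y\<in>Y. \<forall>z\<in>set inflated. y \<le> z \<longrightarrow> z \<in> Y"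
      and pos: "\<forall>y\<in>Y. \<forall>z. before inflated y z \<longrightarrow> z \<in> Y"
    have g: "gapless Y" unfolding gapless_def
    proof (intro ballI allI impI)
      fix x z y assume *: "x \<in> Y" "z \<in> Y" "x \<le> y \<and> y \<le> z"
      then have "y \<in> set inflated" using Y(2) by (auto simp: set_inflated subset_iff)
      then show "y \<in> Y" using val[rule_format, of x y] * by blast
    qed
    have co: "contiguous inflated Y" using Y(2) pos unfolding contiguous_def by blast
    obtain y where y: "y \<in> Y" using Y by blast
    have last: "c k - 1 \<in> block (k - 1)" using c_less[of "k - 1"] k by (auto simp: block_def)
    then have "c k - 1 \<in> set inflated" using k by (intro iffD2[OF in_set_inflated] exI[of _ "k - 1"]) auto
    moreover have "y < c k" using y Y(2) by (auto simp: set_inflated)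
    then have "y \<le> c k - 1" by simp
    ultimately have lY: "c k - 1 \<in> Y" using val[rule_format, of y "c k - 1"] y by blast
    then have m1: "k - 1 \<in> met Y" using last k by (auto simp: met_def)
    obtain m where m: "before (simple_arrangement k) (k - 1) m"
      using simple_arrangement_corners[OF k] by blast
    then have "m < k" "m \<noteq> k - 1"
      using before_in_set[OF m] set_p before_asym[OF distinct_p m] m by auto
    then have "before inflated (c k - 1) (c m)"
      using before_inflated[of "k - 1" m "c k - 1" "c m"] last m k start_in_block[of m] by auto
    then have "c m \<in> Y" using pos lY by blast
    then have "m \<in> met Y" using \<open>m < k\<close> start_in_block[of m] by (auto simp: met_def)
    then show "Y = set inflated" using full[OF g co m1] \<open>m \<noteq> k - 1\<close> set_inflated by metis
  qed
qed


section \<open>Plane trees and the leaf sets of their nodes\<close>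

datatype plane_tree = Leaf | Node "plane_tree list"

primrec leaves :: "plane_tree \<Rightarrow> nat" where
  "leaves Leaf = 1"
| "leaves (Node ts) = sum_list (map leaves ts)"

text \<open>
  A node with one child would have the same leaves below it as the child, and three children do not occur
  for permutations.
\<close>

inductive admissible :: "plane_tree \<Rightarrow> bool" where
  admissible_Leaf: "admissible Leaf"
| admissible_Node: "length ts = 2 \<or> length ts \<ge> 4 \<Longrightarrow> (\<And>t. t \<in> set ts \<Longrightarrow> admissible t) \<Longrightarrow> admissible (Node ts)"

lemma admissible_Node_iff:
  "admissible (Node ts) \<longleftrightarrow> (length ts = 2 \<or> length ts \<ge> 4) \<and> (\<forall>t\<in>set ts. admissible t)"
  by (auto elim: admissible.cases intro: admissible.intros)

text \<open>
  The sets of leaves below the nodes of a tree, if the leaves are numbered consecutively from left to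
  right, starting with \<open>a\<close>.
\<close>

fun spans :: "nat \<Rightarrow> plane_tree \<Rightarrow> nat set set"
  and forest_spans :: "nat \<Rightarrow> plane_tree list \<Rightarrow> nat set set" where
  "spans a Leaf = {{a}}"
| "spans a (Node ts) = insert {a..<a + leaves (Node ts)} (forest_spans a ts)"
| "forest_spans a [] = {}"
| "forest_spans a (t # ts) = spans a t \<union> forest_spans (a + leaves t) ts"

lemma leaves_pos: "admissible t \<Longrightarrow> leaves t \<ge> 1"
proof (induction rule: admissible.induct)
  case (admissible_Node ts)
  then obtain t ts' where "ts = t # ts'" by (cases ts) auto
  then show ?case using admissible_Node.IH[of t] by simp
qed simp

lemma length_le_leaves: "\<forall>t\<in>set ts. admissible t \<Longrightarrow> length ts \<le> sum_list (map leaves ts)"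
  by (induction ts) (fastforce dest: leaves_pos)+

lemma full_span: "{a..<a + leaves t} \<in> spans a t"
  by (cases t) auto

lemma spans_subset:
  shows "admissible t \<Longrightarrow> X \<in> spans a t \<Longrightarrow> X \<noteq> {} \<and> X \<subseteq> {a..<a + leaves t}"
    and "(\<And>t. t \<in> set ts \<Longrightarrow> admissible t) \<Longrightarrow> X \<in> forest_spans a ts \<Longrightarrow>
      X \<noteq> {} \<and> X \<subseteq> {a..<a + sum_list (map leaves ts)}"
proof (induction a t and a ts rule: spans_forest_spans.induct)
  case (2 a ts)
  have "leaves (Node ts) \<ge> 1" using leaves_pos 2(2) by blast
  moreover have "\<forall>t\<in>set ts. admissible t" using 2(2) by (simp add: admissible_Node_iff)
  ultimately show ?case using 2 by auto
next
  case (4 a t ts)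
  then consider "X \<in> spans a t" | "X \<in> forest_spans (a + leaves t) ts" by auto
  then show ?case
  proof cases
    case 1
    then have "X \<noteq> {} \<and> X \<subseteq> {a..<a + leaves t}" using 4 by auto
    then show ?thesis by fastforce
  next
    case 2
    then have "X \<noteq> {} \<and> X \<subseteq> {a + leaves t..<a + leaves t + sum_list (map leaves ts)}" using 4 by auto
    then show ?thesis by fastforce
  qed
qed auto

text \<open>
  Given the number of leaves of the first tree, the spans of the forest can be separated into those of the
  first tree and those of the others. The number itself can also be read off, because the largest span
  containing the first leaf \<open>a\<close> belongs to the root of the first tree.
\<close>

lemma forest_spans_ConsD:
  assumes adm: "admissible t" "\<forall>t\<in>set ts. admissible t"
  shows "spans a t = {X \<in> forest_spans a (t # ts). X \<subseteq> {a..<a + leaves t}}"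
    and "forest_spans (a + leaves t) ts = {X \<in> forest_spans a (t # ts). X \<subseteq> {a + leaves t..}}"
    and "X \<in> forest_spans a (t # ts) \<Longrightarrow> a \<in> X \<Longrightarrow> X \<subseteq> {a..<a + leaves t}"
proof -
  have 1: "X \<noteq> {}" "X \<subseteq> {a..<a + leaves t}" if "X \<in> spans a t" for X
    using spans_subset(1)[OF adm(1) that] by auto
  have 2: "X \<noteq> {}" "X \<subseteq> {a + leaves t..}" if "X \<in> forest_spans (a + leaves t) ts" for X
    using spans_subset(2)[OF _ that] adm by auto
  have disj: "{a..<a + leaves t} \<inter> {a + leaves t..} = {}" by auto
  show "spans a t = {X \<in> forest_spans a (t # ts). X \<subseteq> {a..<a + leaves t}}"
    using 1 2 disj unfolding forest_spans.simps by blast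
  show "forest_spans (a + leaves t) ts = {X \<in> forest_spans a (t # ts). X \<subseteq> {a + leaves t..}}"
    using 1 2 disj unfolding forest_spans.simps by blast
  show "X \<subseteq> {a..<a + leaves t}" if "X \<in> forest_spans a (t # ts)" "a \<in> X"
  proof -
    have "\<not> X \<subseteq> {a + leaves t..}" using that(2) leaves_pos[OF adm(1)] by auto
    then show ?thesis using 1 2 that(1) unfolding forest_spans.simps by blast
  qed
qed

lemma full_span_notin_forest_spans:
  assumes "\<forall>t\<in>set ts. admissible t" "length ts \<ge> 2"
  shows "{a..<a + sum_list (map leaves ts)} \<notin> forest_spans a ts"
proof
  assume *: "{a..<a + sum_list (map leaves ts)} \<in> forest_spans a ts"
  obtain t u us where ts: "ts = t # u # us"
    using assms(2) by (cases ts; cases "tl ts") auto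
  have pos: "leaves t \<ge> 1" "leaves u \<ge> 1" using leaves_pos assms(1) ts by auto
  have "{a..<a + sum_list (map leaves ts)} \<subseteq> {a..<a + leaves t}"
    by (rule forest_spans_ConsD(3)[of t "u # us"]) (use * assms(1) ts pos in auto)
  moreover have "a + leaves t \<in> {a..<a + sum_list (map leaves ts)}" using pos ts by auto
  ultimately have "a + leaves t \<in> {a..<a + leaves t}" by blast
  then show False by simp
qed

text \<open>
  The root is recognised by its span, which is the largest one, and the forest of its subtrees is then
  taken apart from left to right.
\<close>

lemma spans_inject:
  shows "admissible t \<Longrightarrow> admissible t' \<Longrightarrow> spans a t = spans a t' \<Longrightarrow> t = t'"
    and "(\<And>t. t \<in> set ts \<Longrightarrow> admissible t) \<Longrightarrow> (\<And>t. t \<in> set ts' \<Longrightarrow> admissible t)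
      \<Longrightarrow> forest_spans a ts = forest_spans a ts' \<Longrightarrow> ts = ts'"
proof (induction a t and a ts arbitrary: t' and ts' rule: spans_forest_spans.induct)
  case (1 a)
  have "{a..<a + leaves t'} = {a}" using full_span[of a t'] 1(3) by auto
  then have "card {a..<a + leaves t'} = 1" by simp
  then have "leaves t' = 1" by simp
  moreover have "leaves t' \<ge> 2" if "t' = Node us" for us
  proof -
    have "length us \<ge> 2" "\<forall>t\<in>set us. admissible t" using 1(2) that by (auto simp: admissible_Node_iff)
    then show ?thesis using length_le_leaves[of us] that by simp
  qed
  ultimately show ?case by (cases t') auto
next
  case (2 a ts)
  have adm: "\<forall>t\<in>set ts. admissible t" and len: "length ts \<ge> 2"
    using 2(2) by (auto simp: admissible_Node_iff)
  have l2: "leaves (Node ts) \<ge> 2" using length_le_leaves[OF adm] len by simp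
  have eq: "leaves (Node ts) = leaves t'"
  proof -
    have "{a..<a + leaves t'} \<subseteq> {a..<a + leaves (Node ts)}"
      using full_span[of a t'] spans_subset(1)[OF 2(2)] 2(4) by metis
    moreover have "{a..<a + leaves (Node ts)} \<subseteq> {a..<a + leaves t'}"
      using full_span[of a "Node ts"] spans_subset(1)[OF 2(3)] 2(4) by metis
    ultimately have "{a..<a + leaves (Node ts)} = {a..<a + leaves t'}" by blast
    then have "card {a..<a + leaves (Node ts)} = card {a..<a + leaves t'}" by (rule arg_cong)
    then show ?thesis by simp
  qed
  then obtain us where t': "t' = Node us" using l2 by (cases t') auto
  have adm': "\<forall>t\<in>set us. admissible t" and len': "length us \<ge> 2"
    using 2(3) t' by (auto simp: admissible_Node_iff)
  have "forest_spans a ts = forest_spans a us"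
    using 2(4) full_span_notin_forest_spans[OF adm len, of a] full_span_notin_forest_spans[OF adm' len', of a]
      eq unfolding t' spans.simps leaves.simps by (metis Diff_insert_absorb)
  then show ?case using 2(1) adm adm' t' by blast
next
  case (3 a)
  show ?case
  proof (cases ts')
    case (Cons u us)
    then show ?thesis using 3(3) full_span[of a u] by auto
  qed simp
next
  case (4 a t ts)
  obtain u us where ts': "ts' = u # us"
    using 4(5) full_span[of a t] by (cases ts') auto
  have adm: "admissible t" "\<forall>t\<in>set ts. admissible t" "admissible u" "\<forall>t\<in>set us. admissible t"
    using 4(3,4) ts' by auto
  have eq: "forest_spans a (t # ts) = forest_spans a (u # us)" using 4(5) ts' by simp
  have pos: "leaves t \<ge> 1" "leaves u \<ge> 1" using leaves_pos adm by auto
  have "{a..<a + leaves t} \<subseteq> {a..<a + leaves u}"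
    using forest_spans_ConsD(3)[OF adm(3,4), of "{a..<a + leaves t}" a] eq full_span[of a t] pos by auto
  moreover have "{a..<a + leaves u} \<subseteq> {a..<a + leaves t}"
    using forest_spans_ConsD(3)[OF adm(1,2), of "{a..<a + leaves u}" a] eq full_span[of a u] pos by auto
  ultimately have "{a..<a + leaves t} = {a..<a + leaves u}" by blast
  then have "card {a..<a + leaves t} = card {a..<a + leaves u}" by (rule arg_cong)
  then have l: "leaves t = leaves u" by simp
  have eqs: "spans a t = spans a u" "forest_spans (a + leaves t) ts = forest_spans (a + leaves t) us"
    unfolding forest_spans_ConsD(1,2)[OF adm(1,2), of a]
    unfolding eq l
    unfolding forest_spans_ConsD(1,2)[OF adm(3,4), of a, symmetric] by (rule refl)+
  have "t = u" by (rule 4(1)[OF adm(1,3) eqs(1)])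
  moreover have "ts = us" by (rule 4(2)[OF _ _ eqs(2)]) (use adm in blast)+
  ultimately show ?case by (simp add: ts')
qed

lemma spans_laminar:
  shows "admissible t \<Longrightarrow> X \<in> spans a t \<Longrightarrow> Y \<in> spans a t \<Longrightarrow> X \<inter> Y = {} \<or> X \<subseteq> Y \<or> Y \<subseteq> X"
    and "(\<And>t. t \<in> set ts \<Longrightarrow> admissible t) \<Longrightarrow> X \<in> forest_spans a ts \<Longrightarrow> Y \<in> forest_spans a ts
      \<Longrightarrow> X \<inter> Y = {} \<or> X \<subseteq> Y \<or> Y \<subseteq> X"
proof (induction a t and a ts rule: spans_forest_spans.induct)
  case (2 a ts)
  have "X \<subseteq> {a..<a + leaves (Node ts)}" "Y \<subseteq> {a..<a + leaves (Node ts)}"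
    using spans_subset(1) 2(2-4) by blast+
  moreover have "\<forall>t\<in>set ts. admissible t" using 2(2) by (simp add: admissible_Node_iff)
  ultimately show ?case using 2 unfolding spans.simps by blast
next
  case (4 a t ts)
  have adm: "admissible t" "\<forall>t\<in>set ts. admissible t" using 4(3) by simp_all
  have "V \<inter> W = {}" if "V \<in> spans a t" "W \<in> forest_spans (a + leaves t) ts" for V W
  proof -
    have "V \<subseteq> {a..<a + leaves t}" using spans_subset(1)[OF adm(1) that(1)] by blast
    moreover have "W \<subseteq> {a + leaves t..}" using forest_spans_ConsD(2)[OF adm] that(2) by blast
    moreover have "{a..<a + leaves t} \<inter> {a + leaves t..} = {}" by auto
    ultimately show ?thesis by blast
  qed note disj = this
  consider "X \<in> spans a t" "Y \<in> spans a t" | "X \<in> spans a t" "Y \<in> forest_spans (a + leaves t) ts"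
    | "X \<in> forest_spans (a + leaves t) ts" "Y \<in> spans a t"
    | "X \<in> forest_spans (a + leaves t) ts" "Y \<in> forest_spans (a + leaves t) ts"
    using 4(4,5) unfolding forest_spans.simps by blast
  then show ?case
  proof cases
    case 1
    then show ?thesis using 4(1) adm by blast
  next
    case 2
    then show ?thesis using disj by blast
  next
    case 3
    then show ?thesis using disj by blast
  next
    case 4
    then show ?thesis using \<open>(\<And>t. t \<in> set ts \<Longrightarrow> admissible t) \<Longrightarrow> X \<in> forest_spans (a + leaves t) ts \<Longrightarrow>
      Y \<in> forest_spans (a + leaves t) ts \<Longrightarrow> X \<inter> Y = {} \<or> X \<subseteq> Y \<or> Y \<subseteq> X\<close> adm by blast
  qed
qed auto

lemma forest_spans_conv_UN:
  "forest_spans a ts = (\<Union>i<length ts. spans (a + sum_list (map leaves (take i ts))) (ts ! i))"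
proof (induction ts arbitrary: a)
  case (Cons t ts)
  show ?case
    by (simp add: Cons.IH lessThan_Suc_eq_insert_0 image_image add.assoc)
qed simp

text \<open>
  The indecomposability strengthens the induction hypothesis to what the concatenation of two words
  needs. At a binary node the concatenation itself is a direct sum; its reversal has the same intervals
  and is indecomposable.
\<close>

theorem spans_realised_by_word:
  "admissible t \<Longrightarrow> \<exists>w. distinct w \<and> set w = {a..<a + leaves t} \<and> word_intervals w = spans a t
      \<and> sum_indecomposable w"
proof (induction t arbitrary: a rule: admissible.induct)
  case admissible_Leaf
  have "word_intervals [a] = {{a}}"
    by (auto simp: word_intervals_def contiguous_def gapless_def)
  moreover have "sum_indecomposable [a]" by (auto simp: sum_indecomposable_def)
  ultimately show ?case by (intro exI[of _ "[a]"]) auto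
next
  case (admissible_Node ts)
  define k where "k = length ts"
  define c where "c i = a + sum_list (map leaves (take i ts))" for i
  have c_Suc: "c (Suc i) = c i + leaves (ts ! i)" if "i < k" for i
    using that by (simp add: c_def k_def take_Suc_conv_app_nth)
  have c0: "c 0 = a" and ck: "c k = a + leaves (Node ts)" by (simp_all add: c_def k_def)
  have "\<forall>i. \<exists>w. i < k \<longrightarrow> distinct w \<and> set w = {c i..<c (Suc i)} \<and> word_intervals w = spans (c i) (ts ! i)
      \<and> sum_indecomposable w"
    using admissible_Node.IH c_Suc by (metis k_def nth_mem)
  then obtain b where b: "\<And>i. i < k \<Longrightarrow> distinct (b i)" "\<And>i. i < k \<Longrightarrow> set (b i) = {c i..<c (Suc i)}"
      "\<And>i. i < k \<Longrightarrow> word_intervals (b i) = spans (c i) (ts ! i)"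
      "\<And>i. i < k \<Longrightarrow> sum_indecomposable (b i)"
    by metis
  have c_less: "c i < c (Suc i)" if "i < k" for i
    using c_Suc[OF that] leaves_pos[OF admissible_Node.hyps(2), of "ts ! i"] that by (simp add: k_def)
  have infl: "inflation k c b p" if "distinct p" "set p = {..<k}" for p
    using that b c_less by unfold_locales auto
  have spans: "spans a (Node ts) = insert {c 0..<c k} (\<Union>i<k. word_intervals (b i))"
    using b(3) by (simp add: forest_spans_conv_UN c_def k_def)
  show ?case
  proof (cases "k = 2")
    case True
    have "set [0, 1] = {..<k}" using True by (auto simp: less_2_cases_iff)
    then have "inflation 2 c b [0, 1]" using infl[of "[0, 1]"] True by simp
    note * = word_intervals_direct_sum[OF this b(4)[of 0] b(4)[of 1]]
    have UN: "(\<Union>i<k. word_intervals (b i)) = word_intervals (b 0) \<union> word_intervals (b 1)"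
      using True by (auto simp: numeral_2_eq_2 lessThan_Suc)
    have "word_intervals (rev (b 0 @ b 1)) = spans a (Node ts)"
      unfolding word_intervals_rev spans UN using *(1) True by simp
    moreover have "distinct (rev (b 0 @ b 1))"
      using b(1,2)[of 0] b(1,2)[of 1] True by (auto simp: numeral_2_eq_2)
    moreover have "set (rev (b 0 @ b 1)) = {c 0..<c k}"
      using b(2)[of 0] b(2)[of 1] True c_less[of 0] c_less[of 1]
      by (auto simp: numeral_2_eq_2)
    then have "set (rev (b 0 @ b 1)) = {a..<a + leaves (Node ts)}"
      unfolding c0 ck .
    ultimately show ?thesis using *(2) True by (intro exI[of _ "rev (b 0 @ b 1)"] conjI) simp_all
  next
    case False
    then have k: "k \<ge> 4" using admissible_Node.hyps by (auto simp: k_def)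
    have infl': "inflation k c b (simple_arrangement k)"
      using infl set_simple_arrangement[OF k] by blast
    interpret inflation k c b "simple_arrangement k" by (rule infl')
    show ?thesis unfolding spans
    proof (intro exI[of _ inflated] conjI)
      show "set inflated = {a..<a + leaves (Node ts)}" unfolding set_inflated c0 ck ..
      show "word_intervals inflated = insert {c 0..<c k} (\<Union>i<k. word_intervals (b i))"
        unfolding inflated_def by (rule word_intervals_simple_inflation(1)[OF infl' k])
      show "sum_indecomposable inflated"
        unfolding inflated_def by (rule word_intervals_simple_inflation(2)[OF infl' k])
    qed (rule distinct_inflated)
  qed
qed

text \<open>
  The subtrees of the root belong to the maximal members of \<open>S\<close> that are properly contained in the given
  interval. They are collected from left to right: \<open>b\<close> runs through the boundaries between them, the
  points that no proper member crosses.
\<close>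

theorem laminar_family_is_spans:
  fixes S :: "nat set set"
  assumes ivl: "\<And>X. X \<in> S \<Longrightarrow> \<exists>a b. a < b \<and> X = {a..<b}"
    and lam: "\<And>X Y. X \<in> S \<Longrightarrow> Y \<in> S \<Longrightarrow> X \<inter> Y = {} \<or> X \<subseteq> Y \<or> Y \<subseteq> X"
    and three: "\<And>a b c d. a < b \<Longrightarrow> b < c \<Longrightarrow> c < d \<Longrightarrow> {a..<b} \<in> S \<Longrightarrow> {b..<c} \<in> S \<Longrightarrow> {c..<d} \<in> S
      \<Longrightarrow> {a..<d} \<in> S \<Longrightarrow> {a..<c} \<in> S \<or> {b..<d} \<in> S"
    and N: "{a..<a + n} \<in> S"
    and single: "\<And>x. x \<in> {a..<a + n} \<Longrightarrow> {x} \<in> S"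
  shows "\<exists>t. admissible t \<and> leaves t = n \<and> spans a t = {X \<in> S. X \<subseteq> {a..<a + n}}"
  using N single
proof (induction n arbitrary: a rule: less_induct)
  case (less n)
  note IH = less.IH and single = less.prems(2)
  have ne: "X \<noteq> {}" if "X \<in> S" for X using ivl[OF that] by auto
  have "n \<ge> 1" using ne[OF less.prems(1)] by auto
  show ?case
  proof (cases "n = 1")
    case True
    have "{X \<in> S. X \<subseteq> {a..<a + n}} = {{a}}"
      using True ne less.prems(2)[of a] by (auto simp: subset_singleton_iff)
    then show ?thesis using True by (intro exI[of _ Leaf]) (simp add: admissible_Leaf)
  next
    case False
    then have n: "n \<ge> 2" using \<open>n \<ge> 1\<close> by simp
    define e where "e = a + n"
    define P where "P = {X \<in> S. X \<subset> {a..<e}}"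
    have PS: "X \<in> S" "X \<subset> {a..<e}" if "X \<in> P" for X using that by (auto simp: P_def)
    have forest: "\<exists>ts. (\<forall>t\<in>set ts. admissible t) \<and> sum_list (map leaves ts) = e - b
        \<and> forest_spans b ts = {X \<in> P. X \<subseteq> {b..}}"
      if "a \<le> b" "b \<le> e" "\<And>X. X \<in> P \<Longrightarrow> X \<subseteq> {..<b} \<or> X \<subseteq> {b..}" for b
      using that
    proof (induction "e - b" arbitrary: b rule: less_induct)
      case (less b)
      show ?case
      proof (cases "b = e")
        case True
        have False if "X \<in> P" "X \<subseteq> {b..}" for X
        proof -
          have "X \<noteq> {}" "X \<subseteq> {a..<e}" using PS[OF that(1)] ne by auto
          then show False using that(2) True by fastforce
        qed
        then have "{X \<in> P. X \<subseteq> {b..}} = {}" by blast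
        then show ?thesis using True by (intro exI[of _ "[]"]) auto
      next
        case False
        then have be: "b < e" using less.prems by simp
        have "{b} \<in> S" using less.prems(1) be single[of b] by (simp add: e_def)
        moreover have "{b} \<subset> {a..<e}"
        proof
          show "{b} \<subseteq> {a..<e}" using less.prems(1) be by simp
          have "card {a..<e} \<noteq> card {b}" using n by (simp add: e_def)
          then show "{b} \<noteq> {a..<e}" by metis
        qed
        ultimately have bP: "{b} \<in> P \<and> b \<in> {b}" by (simp add: P_def)
        have bound: "\<forall>X. X \<in> P \<and> b \<in> X \<longrightarrow> card X < Suc n"
        proof (intro allI impI)
          fix X assume "X \<in> P \<and> b \<in> X"
          then have "X \<subset> {a..<e}" using PS by blast
          then have "card X < card {a..<e}" by (intro psubset_card_mono) auto
          then show "card X < Suc n" by (simp add: e_def)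
        qed
        obtain M where M: "M \<in> P" "b \<in> M" and Mmax: "\<And>X. X \<in> P \<Longrightarrow> b \<in> X \<Longrightarrow> card X \<le> card M"
          using ex_has_greatest_nat[of "\<lambda>X. X \<in> P \<and> b \<in> X" "{b}" card "Suc n", OF bP] bound
          by (metis less_imp_le)
        obtain u b' where ub: "u < b'" "M = {u..<b'}" using ivl PS(1)[OF M(1)] by blast
        have "M \<subseteq> {b..}" using less.prems(3)[OF M(1)] M(2) by auto
        then have "u = b" using M(2) ub by (auto simp: subset_iff)
        then have Mb: "M = {b..<b'}" "b < b'" using ub by auto
        have b'e: "b' \<le> e" using PS(2)[OF M(1)] Mb by (auto simp: psubset_eq)
        \<comment> \<open>A member crossing the right end of \<open>M\<close> would contain \<open>M\<close>, against its maximality.\<close>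
        have cross: "X \<subseteq> {..<b'} \<or> X \<subseteq> {b'..}" if X: "X \<in> P" for X
        proof (rule ccontr)
          assume *: "\<not> ?thesis"
          obtain v w where vw: "X = {v..<w}" using ivl PS(1)[OF X] by blast
          then have "v < b'" "b' < w" using * by (auto simp: subset_iff)
          have "\<not> X \<subseteq> {..<b}" using vw \<open>b' < w\<close> \<open>v < b'\<close> Mb by (auto simp: subset_iff intro!: exI[of _ b'])
          then have "b \<le> v" using less.prems(3)[OF X] vw \<open>b' < w\<close> \<open>v < b'\<close> by auto
          have "v \<in> M \<inter> X" using \<open>b \<le> v\<close> \<open>v < b'\<close> \<open>b' < w\<close> Mb vw by auto
          moreover have "\<not> X \<subseteq> M" using vw \<open>v < b'\<close> \<open>b' < w\<close> Mb by (auto simp: subset_iff intro!: exI[of _ b'])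
          ultimately have "M \<subseteq> X" using lam[OF PS(1)[OF M(1)] PS(1)[OF X]] by blast
          then have "card X \<le> card M" using Mmax[OF X] M(2) by blast
          moreover have "finite X" using vw by simp
          ultimately have "M = X" using card_seteq[OF _ \<open>M \<subseteq> X\<close>] by blast
          then show False using \<open>\<not> X \<subseteq> M\<close> by simp
        qed
        have lt: "b' - b < n"
        proof -
          have "card M < card {a..<e}" using PS(2)[OF M(1)] by (intro psubset_card_mono) auto
          then show ?thesis using Mb by (simp add: e_def)
        qed
        have MS: "{b..<b + (b' - b)} \<in> S" using Mb PS(1)[OF M(1)] by simp
        have "{x} \<in> S" if "x \<in> {b..<b + (b' - b)}" for x
          using that Mb less.prems(1) b'e single[of x] by (simp add: e_def)
        from IH[OF lt MS this] obtain t where t: "admissible t" "leaves t = b' - b"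
          "spans b t = {X \<in> S. X \<subseteq> {b..<b + (b' - b)}}"
          by blast
        have "e - b' < e - b" "a \<le> b'" using Mb be less.prems(1) by auto
        from less.hyps[OF this b'e cross] obtain ts where
          ts: "\<forall>t\<in>set ts. admissible t" "sum_list (map leaves ts) = e - b'"
            "forest_spans b' ts = {X \<in> P. X \<subseteq> {b'..}}" by blast
        have "forest_spans b (t # ts) = {X \<in> S. X \<subseteq> M} \<union> {X \<in> P. X \<subseteq> {b'..}}"
          using t ts Mb by simp
        also have "\<dots> = {X \<in> P. X \<subseteq> {b..}}"
        proof (intro equalityI subsetI)
          fix X assume "X \<in> {X \<in> S. X \<subseteq> M} \<union> {X \<in> P. X \<subseteq> {b'..}}"
          then show "X \<in> {X \<in> P. X \<subseteq> {b..}}"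
          proof
            assume X: "X \<in> {X \<in> S. X \<subseteq> M}"
            then have "X \<in> P" using PS(2)[OF M(1)] by (auto simp: P_def)
            then show ?thesis using X \<open>M \<subseteq> {b..}\<close> by blast
          next
            assume X: "X \<in> {X \<in> P. X \<subseteq> {b'..}}"
            then have "X \<in> P" "X \<subseteq> {b'..}" by simp_all
            moreover have "{b'..} \<subseteq> {b..}" using Mb by simp
            ultimately show ?thesis using subset_trans[of X "{b'..}" "{b..}"] by simp
          qed
        next
          fix X assume X: "X \<in> {X \<in> P. X \<subseteq> {b..}}"
          then consider "X \<subseteq> {..<b'}" | "X \<subseteq> {b'..}" using cross by blast
          then show "X \<in> {X \<in> S. X \<subseteq> M} \<union> {X \<in> P. X \<subseteq> {b'..}}"
          proof cases
            case 1
            then have "X \<subseteq> M" using X Mb by auto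
            then show ?thesis using X PS by blast
          qed (use X in blast)
        qed
        finally have "forest_spans b (t # ts) = {X \<in> P. X \<subseteq> {b..}}" .
        moreover have "sum_list (map leaves (t # ts)) = e - b" using t ts Mb b'e by simp
        ultimately show ?thesis using t ts by (intro exI[of _ "t # ts"]) auto
      qed
    qed
    have "X \<subseteq> {..<a} \<or> X \<subseteq> {a..}" if "X \<in> P" for X using PS(2)[OF that] by auto
    from forest[OF _ _ this] obtain ts where adm: "\<forall>t\<in>set ts. admissible t"
      and sum: "sum_list (map leaves ts) = n" and fs': "forest_spans a ts = {X \<in> P. X \<subseteq> {a..}}"
      by (auto simp: e_def)
    have "{X \<in> P. X \<subseteq> {a..}} = P" using PS(2) by fastforce
    then have fs: "forest_spans a ts = P" using fs' by simp
    have "ts \<noteq> []" using sum n by auto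
    moreover have "length ts \<noteq> 1"
    proof
      assume "length ts = 1"
      then obtain t where "ts = [t]" by (cases ts) auto
      then have "{a..<e} \<in> P" using full_span[of a t] fs sum by (simp add: e_def)
      then show False using PS by blast
    qed
    moreover have "length ts \<noteq> 3"
    proof
      \<comment> \<open>The third assumption on \<open>S\<close> yields a member that is a union of two of the three spans.\<close>
      assume "length ts = 3"
      then obtain t1 t2 t3 where ts: "ts = [t1, t2, t3]"
        by (auto simp: numeral_3_eq_3 length_Suc_conv)
      let ?b = "a + leaves t1" and ?c = "a + leaves t1 + leaves t2"
      have e: "?c + leaves t3 = e" using sum ts by (simp add: e_def)
      have pos: "leaves t1 \<ge> 1" "leaves t2 \<ge> 1" "leaves t3 \<ge> 1" using leaves_pos adm ts by auto
      have sp: "spans a t1 \<subseteq> P" "spans ?b t2 \<subseteq> P" "spans ?c t3 \<subseteq> P" using fs ts by auto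
      then have "{a..<?b} \<in> S" "{?b..<?c} \<in> S" "{?c..<e} \<in> S"
        using full_span[of a t1] full_span[of ?b t2] full_span[of ?c t3] PS(1) e by auto
      then have "{a..<?c} \<in> S \<or> {?b..<e} \<in> S"
        using three[of a ?b ?c e] pos e less.prems(1) by (auto simp: e_def)
      moreover have "{a..<?c} \<subset> {a..<e}" "{?b..<e} \<subset> {a..<e}"
        using pos e by (auto simp: psubset_eq atLeastLessThan_eq_iff)
      ultimately have "{a..<?c} \<in> P \<or> {?b..<e} \<in> P" by (auto simp: P_def)
      then obtain X where X: "X \<in> P" "?b \<in> X" "X = {a..<?c} \<or> X = {?b..<e}"
        using pos e by auto
      then have "X \<in> spans a t1 \<or> X \<in> spans ?b t2 \<or> X \<in> spans ?c t3"
        unfolding fs[symmetric] ts by simp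
      then have "X \<subseteq> {a..<?b} \<or> X \<subseteq> {?b..<?c} \<or> X \<subseteq> {?c..<e}"
        using spans_subset(1)[of t1 X a] spans_subset(1)[of t2 X ?b] spans_subset(1)[of t3 X ?c] adm ts e by auto
      moreover have "?b \<notin> {a..<?b}" "?b \<notin> {?c..<e}" using pos by simp_all
      ultimately have "X \<subseteq> {?b..<?c}" using X(2) by (meson subsetD)
      then show False using X(3) pos e by auto
    qed
    ultimately have "length ts = 2 \<or> length ts \<ge> 4" by (cases "length ts") auto
    then have "admissible (Node ts)" using adm by (simp add: admissible_Node_iff)
    moreover have "spans a (Node ts) = {X \<in> S. X \<subseteq> {a..<a + n}}"
      using fs sum less.prems(1) by (auto simp: P_def e_def)
    ultimately show ?thesis using sum by (intro exI[of _ "Node ts"]) simp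
  qed
qed


section \<open>Intervals of permutations\<close>

lemma permutes_inv_image:
  assumes "\<sigma> permutes A"
  shows "inv \<sigma> ` \<sigma> ` X = X" "\<sigma> ` inv \<sigma> ` X = X"
  using permutes_inverses[OF assms] by (simp_all add: image_image)

text \<open>
  This form makes values and positions symmetric: an interval is gapless in both.
\<close>

lemma intervals_iff:
  assumes \<sigma>: "\<sigma> permutes {1..n}"
  shows "I \<in> intervals n \<sigma> \<longleftrightarrow> I \<noteq> {} \<and> I \<subseteq> {1..n} \<and> gapless I \<and> gapless (inv \<sigma> ` I)"
proof
  assume "I \<in> intervals n \<sigma>"
  then obtain i j h where *: "1 \<le> i" "i + h \<le> n" "I = {j..j + h}" "\<sigma> ` {i..i + h} = I"
    unfolding intervals_def by blast
  have "inv \<sigma> ` I = {i..i + h}" using *(4) permutes_inv_image(1)[OF \<sigma>] by metis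
  moreover have "I \<subseteq> {1..n}"
    using *(1,2,4) permutes_image[OF \<sigma>] image_mono[of "{i..i+h}" "{1..n}" \<sigma>] by auto
  moreover have "gapless {x..y}" for x y :: nat by (simp add: gapless_def)
  ultimately show "I \<noteq> {} \<and> I \<subseteq> {1..n} \<and> gapless I \<and> gapless (inv \<sigma> ` I)"
    using *(3) by simp
next
  assume I: "I \<noteq> {} \<and> I \<subseteq> {1..n} \<and> gapless I \<and> gapless (inv \<sigma> ` I)"
  then have fin: "finite I" using finite_subset by blast
  have ne: "inv \<sigma> ` I \<noteq> {}" "finite (inv \<sigma> ` I)" using I fin by auto
  obtain j j' where j: "I = {j..j'}" using gapless_eq_atLeastAtMost[of I] I fin by blast
  obtain i i' where i: "inv \<sigma> ` I = {i..i'}" using gapless_eq_atLeastAtMost[of "inv \<sigma> ` I"] I ne by blast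
  have le: "j \<le> j'" "i \<le> i'" using j I ne(1)[unfolded i] by auto
  have "card (inv \<sigma> ` I) = card I"
    by (intro card_image) (use permutes_inj[OF permutes_inv[OF \<sigma>]] in \<open>auto intro: inj_on_subset\<close>)
  then have "i' - i = j' - j" unfolding i unfolding j using le by simp
  then have h: "I = {j..j + (j' - j)}" "inv \<sigma> ` I = {i..i + (j' - j)}" using le i j by auto
  have "inv \<sigma> ` I \<subseteq> inv \<sigma> ` {1..n}" using I by blast
  then have "inv \<sigma> ` I \<subseteq> {1..n}" using permutes_image[OF permutes_inv[OF \<sigma>]] by simp
  then have "1 \<le> i" "i + (j' - j) \<le> n" using h(2) by auto
  moreover have "\<sigma> ` {i..i + (j' - j)} = I"
    unfolding h(2)[symmetric] by (rule permutes_inv_image(2)[OF \<sigma>])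
  ultimately show "I \<in> intervals n \<sigma>" unfolding intervals_def using h(1) by blast
qed

text \<open>
  The blocks \<open>P\<close>, \<open>Q\<close>, \<open>R\<close> are the sets of positions of three consecutive blocks of values. If neither
  union were gapless, then \<open>R\<close> would separate \<open>P\<close> from \<open>Q\<close> and \<open>P\<close> would separate \<open>Q\<close> from \<open>R\<close>, but only
  one of the three can be in the middle.
\<close>

lemma three_blocks:
  assumes "gapless P" "gapless Q" "gapless R" "gapless (P \<union> Q \<union> R)"
    and "P \<inter> Q = {}" "P \<inter> R = {}" "Q \<inter> R = {}"
  shows "gapless (P \<union> Q) \<or> gapless (Q \<union> R)"
proof (rule ccontr)
  have split: "\<exists>x\<in>A. \<exists>z\<in>B. \<exists>y\<in>C. x < y \<and> y < z \<or> z < y \<and> y < x"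
    if h: "gapless A" "gapless B" "gapless (A \<union> B \<union> C)" "\<not> gapless (A \<union> B)" for A B C :: "nat set"
  proof -
    obtain x z y where *: "x \<in> A \<union> B" "z \<in> A \<union> B" "x \<le> y" "y \<le> z" "y \<notin> A \<union> B"
      using h(4) unfolding gapless_def by blast
    then have "y \<in> C" using gaplessD[OF h(3), of x z y] by blast
    moreover have "x < y" "y < z" using * by (metis le_neq_implies_less)+
    moreover have "\<not> (x \<in> A \<and> z \<in> A)" "\<not> (x \<in> B \<and> z \<in> B)"
      using * gaplessD[OF h(1), of x z y] gaplessD[OF h(2), of x z y] by blast+
    ultimately show ?thesis using *(1,2) by blast
  qed
  have apart: "x' < y'" if "gapless A" "gapless B" "A \<inter> B = {}" "x \<in> A" "y \<in> B" "x < y" "x' \<in> A" "y' \<in> B"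
    for A B :: "nat set" and x y x' y'
  proof (rule ccontr)
    assume "\<not> x' < y'"
    then have "y' \<le> x'" by simp
    show False
    proof (cases "y' \<le> x")
      case True
      then have "x \<in> B" using gaplessD[OF that(2), of y' y x] that by simp
      then show False using that(3,4) by blast
    next
      case False
      then have "y' \<in> A" using gaplessD[OF that(1), of x x' y'] that \<open>y' \<le> x'\<close> by simp
      then show False using that(3,8) by blast
    qed
  qed
  assume "\<not> ?thesis"
  then have n: "\<not> gapless (P \<union> Q)" "\<not> gapless (Q \<union> R)" by blast+
  obtain x z y where 1: "x \<in> P" "z \<in> Q" "y \<in> R" "x < y \<and> y < z \<or> z < y \<and> y < x"
    using split[OF assms(1,2,4) n(1)] by blast
  have "Q \<union> R \<union> P = P \<union> Q \<union> R" by blast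
  then obtain x' z' y' where 2: "x' \<in> Q" "z' \<in> R" "y' \<in> P" "x' < y' \<and> y' < z' \<or> z' < y' \<and> y' < x'"
    using split[OF assms(2,3) _ n(2), of P] assms(4) by auto
  show False
    using 1(4)
  proof
    assume "x < y \<and> y < z"
    then have "y' < z'" "z' < x'"
      using apart[OF assms(1,3,6) 1(1,3) _ 2(3,2)] apart[OF assms(3,2) _ 1(3,2) _ 2(2,1)] assms(7) by blast+
    then show False using 2(4) by linarith
  next
    assume "z < y \<and> y < x"
    then have "z' < y'" "x' < z'"
      using apart[OF assms(3,1) _ 1(3,1) _ 2(2,3)] apart[OF assms(2,3,7) 1(2,3) _ 2(1,2)] assms(6) by blast+
    then show False using 2(4) by linarith
  qed
qed

lemma intervals_three_blocks:
  assumes \<sigma>: "\<sigma> permutes {1..n}" and less: "a < b" "b < c" "c < d"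
    and S: "{a..<b} \<in> intervals n \<sigma>" "{b..<c} \<in> intervals n \<sigma>" "{c..<d} \<in> intervals n \<sigma>"
      "{a..<d} \<in> intervals n \<sigma>"
  shows "{a..<c} \<in> intervals n \<sigma> \<or> {b..<d} \<in> intervals n \<sigma>"
proof -
  let ?q = "inv \<sigma>"
  have inj: "inj ?q" using permutes_inj[OF permutes_inv[OF \<sigma>]] .
  have un: "{a..<b} \<union> {b..<c} = {a..<c}" "{b..<c} \<union> {c..<d} = {b..<d}" "{a..<c} \<union> {c..<d} = {a..<d}"
    using less by auto
  have "gapless (?q ` {a..<b} \<union> ?q ` {b..<c}) \<or> gapless (?q ` {b..<c} \<union> ?q ` {c..<d})"
  proof (rule three_blocks)
    show "gapless (?q ` {a..<b})" "gapless (?q ` {b..<c})" "gapless (?q ` {c..<d})"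
      using S intervals_iff[OF \<sigma>] by blast+
    show "gapless (?q ` {a..<b} \<union> ?q ` {b..<c} \<union> ?q ` {c..<d})"
      unfolding image_Un[symmetric] un using S intervals_iff[OF \<sigma>] by blast
    show "?q ` {a..<b} \<inter> ?q ` {b..<c} = {}" "?q ` {a..<b} \<inter> ?q ` {c..<d} = {}"
        "?q ` {b..<c} \<inter> ?q ` {c..<d} = {}"
      unfolding image_Int[OF inj, symmetric] using less by auto
  qed
  then have "gapless (?q ` {a..<c}) \<or> gapless (?q ` {b..<d})"
    unfolding image_Un[symmetric] un .
  moreover have "{a..<d} \<subseteq> {1..n}" using S(4) intervals_iff[OF \<sigma>] by blast
  then have "{a..<c} \<subseteq> {1..n}" "{b..<d} \<subseteq> {1..n}" using un by blast+
  moreover have "{a..<c} \<noteq> {}" "{b..<d} \<noteq> {}" using less by auto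
  ultimately show ?thesis using gapless_atLeastLessThan intervals_iff[OF \<sigma>] by blast
qed

lemma word_as_permutation:
  assumes "distinct w" "set w = {1..n}"
  obtains \<sigma> where "\<sigma> permutes {1..n}" "intervals n \<sigma> = word_intervals w"
proof -
  have len: "length w = n" using assms distinct_card by fastforce
  define \<sigma> where "\<sigma> i = (if i \<in> {1..n} then w ! (i - 1) else i)" for i
  have "bij_betw (\<lambda>i. w ! (i - 1)) {1..n} {1..n}"
  proof -
    have "bij_betw (\<lambda>i. i - 1) {1..n} {..<n}"
      by (rule bij_betw_byWitness[where f' = Suc]) auto
    moreover have "bij_betw ((!) w) {..<n} {1..n}"
      using bij_betw_nth[OF assms(1), of "{..<n}" "{1..n}"] len assms(2) by simp
    ultimately show ?thesis using bij_betw_trans unfolding comp_def by blast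
  qed
  moreover have "\<sigma> i = w ! (i - 1)" if "i \<in> {1..n}" for i using that by (simp only: \<sigma>_def if_True)
  ultimately have "bij_betw \<sigma> {1..n} {1..n}"
    using bij_betw_cong[of "{1..n}" \<sigma> "\<lambda>i. w ! (i - 1)" "{1..n}"] by blast
  then have perm: "\<sigma> permutes {1..n}"
    by (rule bij_imp_permutes) (simp only: \<sigma>_def if_False)
  have pos: "inv \<sigma> (w ! i) = Suc i" if "i < n" for i
  proof -
    have "\<sigma> (Suc i) = w ! i" using that by (simp add: \<sigma>_def)
    then show ?thesis using permutes_inverses(2)[OF perm, of "Suc i"] by simp
  qed
  have bef: "before w x y \<longleftrightarrow> inv \<sigma> x < inv \<sigma> y" if xy: "x \<in> {1..n}" "y \<in> {1..n}" for x y
  proof -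
    obtain i j where ij: "i < n" "w ! i = x" "j < n" "w ! j = y"
      using xy assms(2) len by (metis in_set_conv_nth)
    have "before w x y \<longleftrightarrow> i < j"
      unfolding before_iff_nth using ij len assms(1) by (metis nth_eq_iff_index_eq order.strict_trans)
    then show ?thesis using pos ij by auto
  qed
  have "contiguous w X \<longleftrightarrow> gapless (inv \<sigma> ` X)" if X: "X \<subseteq> {1..n}" for X
  proof
    assume C: "contiguous w X"
    show "gapless (inv \<sigma> ` X)" unfolding gapless_def
    proof (safe)
      fix x z y assume *: "x \<in> X" "z \<in> X" "inv \<sigma> x \<le> y" "y \<le> inv \<sigma> z"
      have y: "inv \<sigma> (\<sigma> y) = y" by (rule permutes_inverses(2)[OF perm])
      have "inv \<sigma> x \<in> {1..n}" "inv \<sigma> z \<in> {1..n}"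
        using * X permutes_in_image[OF permutes_inv[OF perm]] by blast+
      then have "y \<in> {1..n}" using * by auto
      then have "\<sigma> y \<in> {1..n}" using permutes_in_image[OF perm] by blast
      have "\<sigma> y \<in> X"
      proof (cases "inv \<sigma> x = y \<or> inv \<sigma> z = y")
        case True
        then show ?thesis using * permutes_inverses(1)[OF perm] by metis
      next
        case False
        then have "before w x (\<sigma> y)" "before w (\<sigma> y) z"
          using bef[of x "\<sigma> y"] bef[of "\<sigma> y" z] * X \<open>\<sigma> y \<in> {1..n}\<close> y by auto
        then show ?thesis using contiguousD[OF C] * by blast
      qed
      then show "y \<in> inv \<sigma> ` X" using y by (metis imageI)
    qed
  next
    assume G: "gapless (inv \<sigma> ` X)"
    show "contiguous w X" unfolding contiguous_def
    proof (intro conjI ballI allI impI)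
      show "X \<subseteq> set w" using X assms(2) by simp
      fix x z y assume *: "x \<in> X" "z \<in> X" "before w x y \<and> before w y z"
      then have "y \<in> {1..n}" using before_in_set[of w x y] assms(2) by simp
      then have "inv \<sigma> x \<le> inv \<sigma> y" "inv \<sigma> y \<le> inv \<sigma> z"
        using bef[of x y] bef[of y z] * X by auto
      then have "inv \<sigma> y \<in> inv \<sigma> ` X" using gaplessD[OF G] * by blast
      then obtain v where "v \<in> X" "inv \<sigma> y = inv \<sigma> v" by blast
      then show "y \<in> X" using permutes_inverses(1)[OF perm] by metis
    qed
  qed
  then have "I \<in> intervals n \<sigma> \<longleftrightarrow> I \<in> word_intervals w" for I
    unfolding intervals_iff[OF perm] word_intervals_def
    using assms(2) by (auto simp: contiguous_def)
  then show ?thesis using that perm by blast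
qed

lemma singleton_interval:
  assumes "\<sigma> permutes {1..n}" "x \<in> {1..n}" shows "{x} \<in> intervals n \<sigma>"
  using assms(2) by (simp add: intervals_iff[OF assms(1)] gapless_def)

lemma top_interval:
  assumes "\<sigma> permutes {1..n}" "n \<ge> 1" shows "{1..n} \<in> intervals n \<sigma>"
  using assms(2) permutes_image[OF permutes_inv[OF assms(1)]]
  by (simp add: intervals_iff[OF assms(1)] gapless_def)


section \<open>Tree interval posets and plane trees\<close>

definition inclusion_order :: "'a set set \<Rightarrow> 'a set rel" where
  "inclusion_order S = {(I, J). I \<in> S \<and> J \<in> S \<and> I \<subseteq> J}"

lemma inj_inclusion_order: "inj inclusion_order"
proof (rule injI)
  fix S T :: "'a set set"
  have "S = {I. (I, I) \<in> inclusion_order S}" for S :: "'a set set" by (auto simp: inclusion_order_def)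
  then show "inclusion_order S = inclusion_order T \<Longrightarrow> S = T" by metis
qed

lemma interval_poset_eq: "interval_poset n \<sigma> = inclusion_order (intervals n \<sigma>)"
  by (simp add: interval_poset_def inclusion_order_def)

text \<open>
  The minimal elements are the singletons.
\<close>

lemma minimal_elements_interval_poset:
  assumes "\<sigma> permutes {1..n}"
  shows "card (minimal_elements (interval_poset n \<sigma>)) = n"
proof -
  have "minimal_elements (interval_poset n \<sigma>) = (\<lambda>x. {x}) ` {1..n}"
  proof (intro equalityI subsetI)
    fix I assume I: "I \<in> minimal_elements (interval_poset n \<sigma>)"
    then have "I \<in> intervals n \<sigma>" by (simp add: minimal_elements_def Field_interval_poset)
    then obtain x where x: "x \<in> I" "x \<in> {1..n}" using intervals_iff[OF assms] by blast
    then have "({x}, I) \<in> interval_poset n \<sigma>"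
      using singleton_interval[OF assms] \<open>I \<in> intervals n \<sigma>\<close> by (simp add: interval_poset_def)
    then have "{x} = I" using I unfolding minimal_elements_def by blast
    then show "I \<in> (\<lambda>x. {x}) ` {1..n}" using x(2) by blast
  next
    fix I assume "I \<in> (\<lambda>x. {x}) ` {1..n}"
    then obtain x where x: "I = {x}" "x \<in> {1..n}" by blast
    have "J = I" if "(J, I) \<in> interval_poset n \<sigma>" for J
      using that x intervals_iff[OF assms, of J] by (auto simp: interval_poset_def)
    then show "I \<in> minimal_elements (interval_poset n \<sigma>)"
      using singleton_interval[OF assms x(2)] x(1) by (simp add: minimal_elements_def Field_interval_poset)
  qed
  then show ?thesis by (simp add: card_image)
qed

text \<open>
  Two intervals that meet lie above a common singleton, and two intervals above a common one meet.
\<close>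

lemma tree_interval_poset_iff_laminar:
  assumes \<sigma>: "\<sigma> permutes {1..n}" and n: "n \<ge> 1"
  shows "undirected_tree (with_proj (hasse_diagram (interval_poset n \<sigma>))) \<longleftrightarrow>
    (\<forall>X\<in>intervals n \<sigma>. \<forall>Y\<in>intervals n \<sigma>. X \<inter> Y = {} \<or> X \<subseteq> Y \<or> Y \<subseteq> X)"
proof -
  let ?r = "interval_poset n \<sigma>" and ?S = "intervals n \<sigma>"
  have "?S \<subseteq> Pow {1..n}" using intervals_iff[OF \<sigma>] by blast
  then have fin: "finite ?S" by (rule finite_subset) simp
  have top: "(I, {1..n}) \<in> ?r" if "I \<in> ?S" for I
    using that top_interval[OF \<sigma> n] intervals_iff[OF \<sigma>, of I] by (simp add: interval_poset_def)
  have "undirected_tree (with_proj (hasse_diagram ?r)) \<longleftrightarrow>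
      (\<forall>x y z. (x, y) \<in> ?r \<and> (x, z) \<in> ?r \<longrightarrow> (y, z) \<in> ?r \<or> (z, y) \<in> ?r)"
    using partial_order_on_interval_poset[of n \<sigma>] fin top_interval[OF \<sigma> n] top
    by (intro undirected_tree_hasse_diagram_iff[where t = "{1..n}"]) (simp_all only: Field_interval_poset)
  also have "\<dots> \<longleftrightarrow> (\<forall>X\<in>?S. \<forall>Y\<in>?S. X \<inter> Y = {} \<or> X \<subseteq> Y \<or> Y \<subseteq> X)"
  proof
    assume L: "\<forall>x y z. (x, y) \<in> ?r \<and> (x, z) \<in> ?r \<longrightarrow> (y, z) \<in> ?r \<or> (z, y) \<in> ?r"
    show "\<forall>X\<in>?S. \<forall>Y\<in>?S. X \<inter> Y = {} \<or> X \<subseteq> Y \<or> Y \<subseteq> X"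
    proof (intro ballI)
      fix X Y assume XY: "X \<in> ?S" "Y \<in> ?S"
      show "X \<inter> Y = {} \<or> X \<subseteq> Y \<or> Y \<subseteq> X"
      proof (cases "X \<inter> Y = {}")
        case False
        then obtain x where x: "x \<in> X" "x \<in> Y" by blast
        then have "{x} \<in> ?S" using singleton_interval[OF \<sigma>] intervals_iff[OF \<sigma>] XY by blast
        then have "({x}, X) \<in> ?r" "({x}, Y) \<in> ?r" using x XY by (simp_all add: interval_poset_def)
        then have "(X, Y) \<in> ?r \<or> (Y, X) \<in> ?r" using L by blast
        then show ?thesis by (auto simp: interval_poset_def)
      qed simp
    qed
  next
    assume L: "\<forall>X\<in>?S. \<forall>Y\<in>?S. X \<inter> Y = {} \<or> X \<subseteq> Y \<or> Y \<subseteq> X"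
    show "\<forall>x y z. (x, y) \<in> ?r \<and> (x, z) \<in> ?r \<longrightarrow> (y, z) \<in> ?r \<or> (z, y) \<in> ?r"
    proof (intro allI impI, elim conjE)
      fix x y z assume "(x, y) \<in> ?r" "(x, z) \<in> ?r"
      then have *: "x \<in> ?S" "y \<in> ?S" "z \<in> ?S" "x \<subseteq> y" "x \<subseteq> z" by (auto simp: interval_poset_def)
      then have "x \<noteq> {}" using intervals_iff[OF \<sigma>] by blast
      then have "y \<subseteq> z \<or> z \<subseteq> y" using L * by blast
      then show "(y, z) \<in> ?r \<or> (z, y) \<in> ?r" using * by (simp add: interval_poset_def)
    qed
  qed
  finally show ?thesis .
qed

definition trees :: "nat \<Rightarrow> plane_tree set" where
  "trees n = {t. admissible t \<and> leaves t = n}"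

lemma inj_on_spans: "inj_on (spans a) (trees n)"
  by (rule inj_onI) (auto simp: trees_def intro: spans_inject(1))

text \<open>
  The number of minimal elements is the size of the permutation, so only permutations of size \<open>n\<close> matter
  on the left-hand side.
\<close>

theorem tree_interval_posets_eq:
  assumes n: "n \<ge> 1"
  shows "{P. is_tree_interval_poset P \<and> card (minimal_elements P) = n} =
    (\<lambda>t. inclusion_order (spans 1 t)) ` trees n"
proof (intro equalityI subsetI)
  fix P assume "P \<in> {P. is_tree_interval_poset P \<and> card (minimal_elements P) = n}"
  then obtain m \<sigma> where *: "\<sigma> permutes {1..m}" "P = interval_poset m \<sigma>"
      "undirected_tree (with_proj (hasse_diagram P))" "card (minimal_elements P) = n"
    by (auto simp: is_tree_interval_poset_def is_interval_poset_def)
  then have m: "m = n" using minimal_elements_interval_poset by simp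
  note \<sigma> = *(1)[unfolded m]
  have lam: "X \<inter> Y = {} \<or> X \<subseteq> Y \<or> Y \<subseteq> X" if "X \<in> intervals n \<sigma>" "Y \<in> intervals n \<sigma>" for X Y
    using tree_interval_poset_iff_laminar[OF \<sigma> n] *(2,3) m that by simp
  have eq: "{1..<1 + n} = {1..n}" by auto
  have "\<exists>t. admissible t \<and> leaves t = n \<and> spans 1 t = {X \<in> intervals n \<sigma>. X \<subseteq> {1..<1 + n}}"
  proof (rule laminar_family_is_spans)
    show "\<exists>a b. a < b \<and> X = {a..<b}" if X: "X \<in> intervals n \<sigma>" for X
    proof -
      obtain j h where "X = {j..j + h}" using X unfolding intervals_def by blast
      then have "X = {j..<Suc (j + h)}" by auto
      then show ?thesis by (intro exI[of _ j] exI[of _ "Suc (j + h)"]) simp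
    qed
    show "{1..<1 + n} \<in> intervals n \<sigma>" unfolding eq by (rule top_interval[OF \<sigma> n])
    show "{x} \<in> intervals n \<sigma>" if "x \<in> {1..<1 + n}" for x
      using singleton_interval[OF \<sigma>] that unfolding eq .
    show "X \<inter> Y = {} \<or> X \<subseteq> Y \<or> Y \<subseteq> X" if "X \<in> intervals n \<sigma>" "Y \<in> intervals n \<sigma>" for X Y
      by (rule lam[OF that])
    show "{a..<c} \<in> intervals n \<sigma> \<or> {b..<d} \<in> intervals n \<sigma>"
      if "a < b" "b < c" "c < d" "{a..<b} \<in> intervals n \<sigma>" "{b..<c} \<in> intervals n \<sigma>"
        "{c..<d} \<in> intervals n \<sigma>" "{a..<d} \<in> intervals n \<sigma>" for a b c d
      by (rule intervals_three_blocks[OF \<sigma> that])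
  qed
  moreover have "{X \<in> intervals n \<sigma>. X \<subseteq> {1..<1 + n}} = intervals n \<sigma>"
    unfolding eq using intervals_iff[OF \<sigma>] by blast
  ultimately obtain t where "t \<in> trees n" "spans 1 t = intervals n \<sigma>" by (auto simp: trees_def)
  then show "P \<in> (\<lambda>t. inclusion_order (spans 1 t)) ` trees n"
    using *(2) m interval_poset_eq by (metis imageI)
next
  fix P assume "P \<in> (\<lambda>t. inclusion_order (spans 1 t)) ` trees n"
  then obtain t where t: "admissible t" "leaves t = n" "P = inclusion_order (spans 1 t)"
    by (auto simp: trees_def)
  obtain w where w: "distinct w" "set w = {1..<1 + n}" "word_intervals w = spans 1 t"
    using spans_realised_by_word[OF t(1), of 1] t(2) by blast
  have "set w = {1..n}" unfolding w(2) by auto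
  then obtain \<sigma> where \<sigma>: "\<sigma> permutes {1..n}" "intervals n \<sigma> = word_intervals w"
    by (rule word_as_permutation[OF w(1)])
  have ints: "intervals n \<sigma> = spans 1 t" unfolding \<sigma>(2) by (rule w(3))
  have P: "P = interval_poset n \<sigma>" by (simp add: t(3) interval_poset_eq ints)
  have "undirected_tree (with_proj (hasse_diagram (interval_poset n \<sigma>)))"
    unfolding tree_interval_poset_iff_laminar[OF \<sigma>(1) n] ints
    by (intro ballI spans_laminar(1)[OF t(1)])
  moreover have "is_interval_poset P" unfolding P is_interval_poset_def using \<sigma>(1) by blast
  ultimately show "P \<in> {P. is_tree_interval_poset P \<and> card (minimal_elements P) = n}"
    using minimal_elements_interval_poset[OF \<sigma>(1)] by (simp add: P is_tree_interval_poset_def)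
qed

lemma num_tree_interval_posets_eq:
  assumes "n \<ge> 1"
  shows "num_tree_interval_posets n = card (trees n)"
proof -
  have "inj_on (\<lambda>t. inclusion_order (spans 1 t)) (trees n)"
    using comp_inj_on[OF inj_on_spans inj_on_subset[OF inj_inclusion_order subset_UNIV]] by (simp add: comp_def)
  then show ?thesis
    unfolding num_tree_interval_posets_def tree_interval_posets_eq[OF assms] by (rule card_image)
qed


section \<open>Counting plane trees\<close>

definition forests :: "nat \<Rightarrow> nat \<Rightarrow> plane_tree list set" where
  "forests k n = {ts. length ts = k \<and> (\<forall>t\<in>set ts. admissible t) \<and> sum_list (map leaves ts) = n}"

lemma finite_trees: "finite (trees n)"
proof (rule finite_imageD[OF _ inj_on_spans])
  have "spans 0 ` trees n \<subseteq> Pow (Pow {0..<n})"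
    using spans_subset(1)[where a = 0] by (auto simp: trees_def)
  then show "finite (spans 0 ` trees n)" by (rule finite_subset) simp
qed

lemma trees_0: "trees 0 = {}"
  using leaves_pos by (force simp: trees_def)

lemma forests_0: "forests 0 n = (if n = 0 then {[]} else {})"
  by (auto simp: forests_def)

lemma forests_Suc:
  "forests (Suc k) n = (\<Union>m\<le>n. (\<lambda>(t, ts). t # ts) ` (trees m \<times> forests k (n - m)))"
proof (intro equalityI subsetI)
  fix us assume "us \<in> forests (Suc k) n"
  then have us: "length us = Suc k" "\<forall>t\<in>set us. admissible t" "sum_list (map leaves us) = n"
    by (simp_all add: forests_def)
  then obtain t ts where ts: "us = t # ts" by (cases us) simp_all
  have "t \<in> trees (leaves t)" "leaves t \<le> n" "ts \<in> forests k (n - leaves t)"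
    using us unfolding ts by (simp_all add: trees_def forests_def)
  then have "us \<in> (\<lambda>(t, ts). t # ts) ` (trees (leaves t) \<times> forests k (n - leaves t))"
    using ts by blast
  then show "us \<in> (\<Union>m\<le>n. (\<lambda>(t, ts). t # ts) ` (trees m \<times> forests k (n - m)))"
    using \<open>leaves t \<le> n\<close> by blast
qed (auto simp: forests_def trees_def)

lemma finite_forests: "finite (forests k n)"
  by (induction k arbitrary: n) (auto simp: forests_0 forests_Suc finite_trees)

lemma card_forests_Suc:
  "card (forests (Suc k) n) = (\<Sum>m\<le>n. card (trees m) * card (forests k (n - m)))"
proof -
  have "card (forests (Suc k) n) =
      (\<Sum>m\<le>n. card ((\<lambda>(t, ts). t # ts) ` (trees m \<times> forests k (n - m))))"
    unfolding forests_Suc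
    by (rule card_UN_disjoint) (simp_all add: finite_trees finite_forests, auto simp: trees_def)
  also have "\<dots> = (\<Sum>m\<le>n. card (trees m \<times> forests k (n - m)))"
    by (intro sum.cong refl card_image) (auto simp: inj_on_def)
  finally show ?thesis by (simp add: card_cartesian_product)
qed

definition node_degrees :: "nat set" where "node_degrees = {k. k = 2 \<or> k \<ge> 4}"

lemma trees_eq: "trees n = (if n = 1 then {Leaf} else {}) \<union> Node ` (\<Union>k\<in>node_degrees \<inter> {0..n}. forests k n)"
proof (intro equalityI subsetI)
  fix t assume t: "t \<in> trees n"
  show "t \<in> (if n = 1 then {Leaf} else {}) \<union> Node ` (\<Union>k\<in>node_degrees \<inter> {0..n}. forests k n)"
  proof (cases t)
    case Leaf
    then show ?thesis using t by (auto simp: trees_def)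
  next
    case (Node ts)
    then have "length ts \<in> node_degrees" "\<forall>t\<in>set ts. admissible t" "sum_list (map leaves ts) = n"
      using t by (auto simp: trees_def admissible_Node_iff node_degrees_def)
    then show ?thesis using Node length_le_leaves[of ts] by (auto simp: forests_def)
  qed
next
  fix t assume "t \<in> (if n = 1 then {Leaf} else {}) \<union> Node ` (\<Union>k\<in>node_degrees \<inter> {0..n}. forests k n)"
  then show "t \<in> trees n"
    by (auto simp: trees_def forests_def node_degrees_def admissible_Node_iff admissible_Leaf split: if_splits)
qed

lemma card_trees:
  "card (trees n) = (if n = 1 then 1 else 0) + (\<Sum>k\<in>node_degrees \<inter> {0..n}. card (forests k n))"
proof -
  have "card (trees n) = card (if n = 1 then {Leaf} else {}) + card (Node ` (\<Union>k\<in>node_degrees \<inter> {0..n}. forests k n))"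
    unfolding trees_eq by (rule card_Un_disjoint) (auto simp: finite_forests)
  also have "card (Node ` (\<Union>k\<in>node_degrees \<inter> {0..n}. forests k n)) = card (\<Union>k\<in>node_degrees \<inter> {0..n}. forests k n)"
    by (rule card_image) (auto simp: inj_on_def)
  also have "\<dots> = (\<Sum>k\<in>node_degrees \<inter> {0..n}. card (forests k n))"
    by (rule card_UN_disjoint) (simp_all add: finite_forests, auto simp: forests_def)
  finally show ?thesis by simp
qed

lemma card_trees_1: "card (trees 1) = 1"
proof -
  have "node_degrees \<inter> {0..1} = {}" by (auto simp: node_degrees_def)
  then show ?thesis by (simp add: card_trees)
qed

unbundle fps_syntax


section \<open>Lagrange inversion\<close>

text \<open>
  As \<open>F\<close> has no constant term, only the powers of \<open>F\<close> up to the \<open>m\<close>-th contribute in degree \<open>m\<close>.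
\<close>

lemma fps_compose_mult_nth:
  fixes G F H :: "'a::comm_ring_1 fps"
  assumes "F $ 0 = 0"
  shows "((G oo F) * H) $ m = (\<Sum>k=0..m. G $ k * (F ^ k * H) $ m)"
proof -
  have "((G oo F) * H) $ m = (\<Sum>i=0..m. (\<Sum>k=0..i. G $ k * (F ^ k) $ i) * H $ (m - i))"
    by (simp add: fps_mult_nth fps_compose_nth)
  also have "\<dots> = (\<Sum>i=0..m. (\<Sum>k=0..m. G $ k * (F ^ k) $ i) * H $ (m - i))"
  proof (rule sum.cong[OF refl])
    fix i assume "i \<in> {0..m}"
    then have "(\<Sum>k=0..i. G $ k * (F ^ k) $ i) = (\<Sum>k=0..m. G $ k * (F ^ k) $ i)"
      by (intro sum.mono_neutral_left) (auto simp: startsby_zero_power_prefix[OF assms])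
    then show "(\<Sum>k=0..i. G $ k * (F ^ k) $ i) * H $ (m - i)
        = (\<Sum>k=0..m. G $ k * (F ^ k) $ i) * H $ (m - i)"
      by simp
  qed
  also have "\<dots> = (\<Sum>k=0..m. G $ k * (F ^ k * H) $ m)"
    by (simp add: fps_mult_nth sum_distrib_left sum_distrib_right mult.assoc)
       (rule sum.swap)
  finally show ?thesis .
qed

text \<open>
  With \<open>F = x / \<phi>\<close>, this is the residue of \<open>F'\<close> divided by the \<open>(j + 1)\<close>-st power of \<open>F\<close>. For \<open>j > 0\<close>
  that quotient is the derivative of a Laurent series and has no residue; for \<open>j = 0\<close> it is a
  logarithmic derivative, and its residue is the order \<open>1\<close> of \<open>F\<close>. Multiplication by a power of \<open>x\<close> keeps
  everything within power series.
\<close>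

lemma residue_power_deriv:
  fixes \<phi> :: "'a::field_char_0 fps"
  assumes "\<phi> $ 0 \<noteq> 0"
  shows "(\<phi> ^ Suc j * fps_deriv (fps_X * inverse \<phi>)) $ j = (if j = 0 then 1 else 0)"
proof -
  have inv: "\<phi> * inverse \<phi> = 1"
    using assms by (simp add: inverse_mult_eq_1')
  have d: "fps_deriv (fps_X * inverse \<phi>) = inverse \<phi> - fps_X * fps_deriv \<phi> * (inverse \<phi>)\<^sup>2"
    using assms by (simp add: fps_inverse_deriv algebra_simps)
  show ?thesis
  proof (cases j)
    case 0
    then show ?thesis using assms by (simp add: d)
  next
    case (Suc i)
    have "\<phi> ^ Suc j * fps_deriv (fps_X * inverse \<phi>) =
        \<phi> ^ j * (\<phi> * inverse \<phi>) - fps_X * (\<phi> ^ i * fps_deriv \<phi>) * (\<phi> * inverse \<phi>)\<^sup>2"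
      unfolding d by (simp add: Suc algebra_simps power2_eq_square)
    also have "\<dots> = \<phi> ^ j - fps_X * (\<phi> ^ i * fps_deriv \<phi>)"
      by (simp add: inv)
    finally have e: "\<phi> ^ Suc j * fps_deriv (fps_X * inverse \<phi>) = \<phi> ^ j - fps_X * (\<phi> ^ i * fps_deriv \<phi>)" .
    have "fps_deriv (\<phi> ^ j) = fps_const (of_nat j) * (\<phi> ^ i * fps_deriv \<phi>)"
      by (simp only: fps_deriv_power Suc diff_Suc_1 mult_ac)
    then have "fps_deriv (\<phi> ^ j) $ i = of_nat j * (\<phi> ^ i * fps_deriv \<phi>) $ i"
      by simp
    moreover have "fps_deriv (\<phi> ^ j) $ i = of_nat j * (\<phi> ^ j) $ j"
      by (simp only: fps_deriv_nth Suc Suc_eq_plus1)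
    ultimately have "of_nat j * (\<phi> ^ j) $ j = of_nat j * (\<phi> ^ i * fps_deriv \<phi>) $ i"
      by (simp only:)
    then have "(\<phi> ^ j) $ j = (\<phi> ^ i * fps_deriv \<phi>) $ i"
      using Suc by (metis mult_left_cancel of_nat_eq_0_iff nat.distinct(1))
    then show ?thesis unfolding e by (simp add: Suc)
  qed
qed

text \<open>
  The series \<open>T\<close> is the compositional inverse of \<open>F = x / \<phi>\<close>. Differentiating \<open>T(F(x)) = x\<close> yields
  \<open>T'(F(x)) F'(x) = 1\<close>. Multiplied by the \<open>n\<close>-th power of \<open>\<phi>\<close>, which is that of \<open>x / F\<close>, the
  term of \<open>T'\<close> with coefficient \<open>n T\<^sub>n\<close> is by the residue computation the only one that contributes to
  the coefficient of degree \<open>n - 1\<close>.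
\<close>

theorem lagrange_inversion:
  fixes \<phi> T :: "'a::field_char_0 fps"
  assumes \<phi>0: "\<phi> $ 0 \<noteq> 0" and T0: "T $ 0 = 0" and T: "T = fps_X * (\<phi> oo T)" and n: "n \<ge> 1"
  shows "of_nat n * T $ n = (\<phi> ^ n) $ (n - 1)"
proof -
  define F where "F = fps_X * inverse \<phi>"
  have F0: "F $ 0 = 0" and F1: "F $ 1 \<noteq> 0" using \<phi>0 by (auto simp: F_def)
  have c0: "(\<phi> oo T) $ 0 \<noteq> 0" using \<phi>0 by simp
  have "F oo T = T * inverse (\<phi> oo T)"
    using T0 \<phi>0 by (simp add: F_def fps_compose_mult_distrib fps_inverse_compose)
  also have "\<dots> = fps_X * ((\<phi> oo T) * inverse (\<phi> oo T))"
    by (subst T) (simp add: mult.assoc)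
  also have "\<dots> = fps_X"
    using inverse_mult_eq_1'[OF c0] by simp
  finally have FT: "F oo T = fps_X" .
  have "T = (fps_inv F oo F) oo T"
    using fps_inv[OF F0 F1] T0 by simp
  also have "\<dots> = fps_inv F oo (F oo T)"
    using T0 F0 by (simp add: fps_compose_assoc)
  finally have "T = fps_inv F" by (simp add: FT)
  then have TF: "T oo F = fps_X" using fps_inv[OF F0 F1] by simp
  then have "(fps_deriv T oo F) * fps_deriv F = 1"
    using fps_compose_deriv[OF F0, of T] by simp
  then have "(\<phi> ^ n) $ (n-1) = ((fps_deriv T oo F) * (fps_deriv F * \<phi> ^ n)) $ (n-1)"
    by (simp flip: mult.assoc)
  also have "\<dots> = (\<Sum>k=0..n-1. fps_deriv T $ k * (F ^ k * (fps_deriv F * \<phi> ^ n)) $ (n-1))"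
    by (rule fps_compose_mult_nth[OF F0])
  also have "\<dots> = (\<Sum>k=0..n-1. fps_deriv T $ k * (if k = n - 1 then 1 else 0))"
  proof (intro sum.cong refl arg_cong2[where f="(*)"])
    fix k assume k: "k \<in> {0..n-1}"
    have "\<phi> ^ n = \<phi> ^ k * \<phi> ^ Suc (n - 1 - k)"
      unfolding power_add[symmetric] using k n by (intro arg_cong2[where f="(^)"]) auto
    then have "F ^ k * (fps_deriv F * \<phi> ^ n)
        = fps_X ^ k * (inverse \<phi> * \<phi>) ^ k * (\<phi> ^ Suc (n - 1 - k) * fps_deriv F)"
      by (simp add: F_def power_mult_distrib algebra_simps)
    also have "\<dots> = fps_X ^ k * (\<phi> ^ Suc (n - 1 - k) * fps_deriv F)"
      using inverse_mult_eq_1[OF \<phi>0] by simp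
    finally have *: "F ^ k * (fps_deriv F * \<phi> ^ n) = fps_X ^ k * (\<phi> ^ Suc (n - 1 - k) * fps_deriv F)" .
    have "(F ^ k * (fps_deriv F * \<phi> ^ n)) $ (n-1) = (\<phi> ^ Suc (n - 1 - k) * fps_deriv F) $ (n-1-k)"
      unfolding * using k by (simp add: fps_X_power_mult_nth del: power_Suc)
    then show "(F ^ k * (fps_deriv F * \<phi> ^ n)) $ (n-1) = (if k = n - 1 then 1 else 0)"
      using residue_power_deriv[OF \<phi>0, of "n-1-k"] k by (auto simp: F_def simp del: power_Suc)
  qed
  also have "\<dots> = of_nat n * T $ n"
    using n by (simp add: if_distrib cong: if_cong)
  finally show ?thesis by simp
qed


section \<open>The generating function and its coefficients\<close>

definition tree_gf :: "real fps" where "tree_gf = Abs_fps (\<lambda>n. real (card (trees n)))"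

lemma tree_gf_power_nth: "tree_gf ^ k $ n = real (card (forests k n))"
proof (induction k arbitrary: n)
  case (Suc k)
  then show ?case
    by (simp add: fps_mult_nth tree_gf_def card_forests_Suc atMost_atLeast0)
qed (simp add: forests_0)

text \<open>
  The degrees \<open>2, 4, 5, \<dots>\<close> have the generating function \<open>y B\<close> with \<open>B = y + y\<^sup>3 / (1 - y)\<close>, so splitting
  off the root gives \<open>T = x + T B(T)\<close>, which is solved for the factor \<open>T\<close>.
\<close>

lemma tree_gf_equation:
  "tree_gf = fps_X * (inverse (1 - (fps_X + fps_X ^ 3 * inverse (1 - fps_X))) oo tree_gf)"
proof -
  let ?T = tree_gf
  define B :: "real fps" where "B = fps_X + fps_X ^ 3 * inverse (1 - fps_X)"
  have T0: "?T $ 0 = 0" by (simp add: tree_gf_def trees_0)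
  have B0: "B $ 0 = 0" by (simp add: B_def)
  have A: "(fps_X * B) $ k = (if k \<in> node_degrees then 1 else 0)" for k
  proof -
    have "fps_X * B = fps_X ^ 2 + fps_X ^ 4 * Abs_fps (\<lambda>n. 1)"
      by (simp add: B_def fps_inverse_one_minus_fps_X algebra_simps power2_eq_square power_numeral_reduce)
    then have "(fps_X * B) $ k = fps_X ^ 2 $ k + (fps_X ^ 4 * Abs_fps (\<lambda>n. 1)) $ k"
      by simp
    then show ?thesis by (simp add: fps_X_power_mult_nth fps_X_power_nth node_degrees_def)
  qed
  have "?T = fps_X + (fps_X * B oo ?T)"
  proof (rule fps_ext)
    fix n
    have "((fps_X * B) oo ?T) $ n = (\<Sum>k=0..n. if k \<in> node_degrees then real (card (forests k n)) else 0)"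
      unfolding fps_compose_nth A tree_gf_power_nth by (intro sum.cong refl) simp
    also have "\<dots> = (\<Sum>k\<in>node_degrees \<inter> {0..n}. real (card (forests k n)))"
      by (simp add: sum.If_cases Int_commute)
    finally show "?T $ n = (fps_X + (fps_X * B oo ?T)) $ n"
      unfolding fps_add_nth fps_X_nth by (simp add: tree_gf_def card_trees)
  qed
  also have "fps_X * B oo ?T = ?T * (B oo ?T)"
    using T0 by (simp add: fps_compose_mult_distrib)
  finally have "?T * (1 - (B oo ?T)) = fps_X" by (simp add: algebra_simps)
  moreover have "1 - (B oo ?T) = (1 - B) oo ?T" by (simp add: fps_compose_sub_distrib)
  ultimately have X: "fps_X = ?T * ((1 - B) oo ?T)" by simp
  have "((1 - B) oo ?T) $ 0 \<noteq> 0" using B0 by simp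
  then have "?T = ?T * ((1 - B) oo ?T) * inverse ((1 - B) oo ?T)"
    using inverse_mult_eq_1' by (metis mult.assoc mult_1_right)
  also have "\<dots> = fps_X * inverse ((1 - B) oo ?T)" unfolding X[symmetric] ..
  also have "inverse ((1 - B) oo ?T) = inverse (1 - B) oo ?T"
    using T0 B0 by (simp add: fps_inverse_compose)
  finally show ?thesis unfolding B_def .
qed

lemma fps_inverse_one_minus_X_power_nth:
  "(inverse (1 - fps_X) ^ Suc k) $ m = (of_nat ((m + k) choose k) :: 'a::field_char_0)"
proof (induction k arbitrary: m)
  case 0
  show ?case by (simp add: fps_inverse_one_minus_fps_X)
next
  case (Suc k)
  have "(inverse (1 - fps_X) ^ Suc (Suc k) :: 'a fps) $ m
      = (inverse (1 - fps_X) ^ Suc k * Abs_fps (\<lambda>n. 1)) $ m"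
    by (simp only: power_Suc2[of _ "Suc k"] fps_inverse_one_minus_fps_X)
  also have "\<dots> = (\<Sum>i=0..m. of_nat ((i + k) choose k))"
    by (simp only: fps_mult_nth Suc.IH fps_nth_Abs_fps mult_1_right)
  also have "\<dots> = of_nat (\<Sum>i\<le>m. (k + i) choose k)"
    by (simp add: atMost_atLeast0 add.commute)
  also have "(\<Sum>i\<le>m. (k + i) choose k) = (m + Suc k) choose Suc k"
    using choose_rising_sum(1)[of k m] by (simp add: add.commute)
  finally show ?case .
qed

text \<open>
  Two expansions: that of \<open>1 / (1 - u)\<close> to the \<open>n\<close>-th power in powers of \<open>u = y + y\<^sup>3 / (1 - y)\<close>, and the
  binomial theorem for each power of \<open>u\<close>. The bounds on \<open>i\<close> and \<open>k\<close> express that the exponent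
  \<open>i + 2 k\<close> of the leading monomial does not exceed \<open>n - 1\<close>.
\<close>

lemma nth_power_tree_series:
  fixes \<phi> :: "real fps"
  assumes n: "n \<ge> 2"
  defines "\<phi> \<equiv> inverse (1 - (fps_X + fps_X ^ 3 * inverse (1 - fps_X)))"
  shows "(\<phi> ^ n) $ (n - 1) =
      (\<Sum>i = 1..n - 3. \<Sum>k = 1..min i ((n - i - 1) div 2).
           real ((n + i - 1) choose i) * real (i choose k) * real ((n - i - k - 2) choose (k - 1)))
        + real ((2 * n - 2) choose (n - 1))"
proof -
  define u :: "real fps" where "u = fps_X + fps_X ^ 3 * inverse (1 - fps_X)"
  define I :: "real fps" where "I = inverse (1 - fps_X)"
  have u0: "u $ 0 = 0" by (simp add: u_def)
  have "\<phi> = inverse (1 - fps_X) oo u"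
    using u0 by (simp add: \<phi>_def u_def[symmetric] fps_inverse_compose fps_compose_sub_distrib)
  then have \<phi>n: "\<phi> ^ n = inverse (1 - fps_X) ^ n oo u"
    using u0 by (simp add: fps_compose_power)
  have coeff: "(inverse (1 - fps_X) ^ n) $ i = real ((n + i - 1) choose i)" for i
    using fps_inverse_one_minus_X_power_nth[of "n - 1" i, where 'a=real] n
      binomial_symmetric[of i "n + i - 1"]
    by (simp add: add.commute)
  have uk: "u ^ i $ m = (\<Sum>k=0..i. real (i choose k) * (if m < i + 2 * k then 0 else (I ^ k) $ (m - (i + 2 * k))))"
    for i m
  proof -
    have "u ^ i = (\<Sum>k\<le>i. of_nat (i choose k) * (fps_X ^ 3 * I) ^ k * fps_X ^ (i - k))"
      unfolding u_def I_def by (subst add.commute) (rule binomial_ring)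
    also have "\<dots> = (\<Sum>k\<le>i. of_nat (i choose k) * (fps_X ^ (i + 2 * k) * I ^ k))"
    proof (rule sum.cong[OF refl])
      fix k assume "k \<in> {..i}"
      then have "i + 2 * k = 3 * k + (i - k)" by auto
      then have "fps_X ^ (i + 2 * k) = (fps_X ^ 3) ^ k * (fps_X ^ (i - k) :: real fps)"
        by (simp only: power_add power_mult)
      then show "of_nat (i choose k) * (fps_X ^ 3 * I) ^ k * fps_X ^ (i - k)
          = of_nat (i choose k) * (fps_X ^ (i + 2 * k) * I ^ k)"
        by (simp only: power_mult_distrib mult_ac)
    qed
    finally have "u ^ i $ m = (\<Sum>k\<le>i. of_nat (i choose k) * (fps_X ^ (i + 2 * k) * I ^ k) $ m)"
      by (simp add: fps_sum_nth flip: fps_of_nat)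
    then show ?thesis
      by (simp add: fps_X_power_mult_nth atMost_atLeast0)
  qed
  let ?c = "\<lambda>i k. real ((n + i - 1) choose i) * real (i choose k) * real ((n - i - k - 2) choose (k - 1))"
  have inner: "u ^ i $ (n - 1) = (if i = n - 1 then 1 else 0) +
      (\<Sum>k = 1..min i ((n - i - 1) div 2). real (i choose k) * real ((n - i - k - 2) choose (k - 1)))"
    if i: "i \<le> n - 1" for i
  proof -
    let ?f = "\<lambda>k. real (i choose k) * (if n - 1 < i + 2 * k then 0 else (I ^ k) $ (n - 1 - (i + 2 * k)))"
    have "u ^ i $ (n - 1) = ?f 0 + (\<Sum>k=1..i. ?f k)"
      unfolding uk by (simp add: sum.atLeast_Suc_atMost)
    also have "?f 0 = (if i = n - 1 then 1 else 0)"
      using i by auto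
    also have "(\<Sum>k=1..i. ?f k) = (\<Sum>k = 1..min i ((n - i - 1) div 2). ?f k)"
      using i by (intro sum.mono_neutral_right) auto
    also have "\<dots> = (\<Sum>k = 1..min i ((n - i - 1) div 2). real (i choose k) * real ((n - i - k - 2) choose (k - 1)))"
    proof (rule sum.cong[OF refl])
      fix k assume k: "k \<in> {1..min i ((n - i - 1) div 2)}"
      then have "2 * k \<le> n - i - 1" "k \<ge> 1" by auto
      then have "n - 1 - (i + 2 * k) + (k - 1) = n - i - k - 2" "\<not> n - 1 < i + 2 * k" by linarith+
      then show "?f k = real (i choose k) * real ((n - i - k - 2) choose (k - 1))"
        using fps_inverse_one_minus_X_power_nth[of "k - 1" "n - 1 - (i + 2 * k)", where 'a=real] \<open>k \<ge> 1\<close>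
        by (simp add: I_def)
    qed
    finally show ?thesis .
  qed
  have "(\<phi> ^ n) $ (n - 1) = (\<Sum>i=0..n-1. real ((n + i - 1) choose i) * u ^ i $ (n - 1))"
    by (simp add: \<phi>n fps_compose_nth coeff)
  also have "\<dots> = (\<Sum>i=0..n-1. (if i = n - 1 then real ((n + i - 1) choose i) else 0)
      + (\<Sum>k = 1..min i ((n - i - 1) div 2). ?c i k))"
  proof (rule sum.cong[OF refl])
    fix i assume "i \<in> {0..n-1}"
    then have "i \<le> n - 1" by simp
    then show "real ((n + i - 1) choose i) * u ^ i $ (n - 1) =
        (if i = n - 1 then real ((n + i - 1) choose i) else 0)
        + (\<Sum>k = 1..min i ((n - i - 1) div 2). ?c i k)"
      unfolding inner[OF \<open>i \<le> n - 1\<close>] by (simp add: distrib_left sum_distrib_left mult.assoc)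
  qed
  also have "\<dots> = real ((n + (n - 1) - 1) choose (n - 1))
      + (\<Sum>i=0..n-1. \<Sum>k = 1..min i ((n - i - 1) div 2). ?c i k)"
    by (simp add: sum.distrib)
  also have "(\<Sum>i=0..n-1. \<Sum>k = 1..min i ((n - i - 1) div 2). ?c i k)
      = (\<Sum>i=1..n-3. \<Sum>k = 1..min i ((n - i - 1) div 2). ?c i k)"
    by (intro sum.mono_neutral_right) auto
  also have "n + (n - 1) - 1 = 2 * n - 2" using n by simp
  finally show ?thesis by simp
qed

theorem card_trees_closed_form:
  assumes "n \<ge> 2"
  shows "real n * real (card (trees n)) =
    (\<Sum>i = 1..n - 3. \<Sum>k = 1..min i ((n - i - 1) div 2).
       real ((n + i - 1) choose i) * real (i choose k) * real ((n - i - k - 2) choose (k - 1)))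
    + real ((2 * n - 2) choose (n - 1))"
proof -
  have "real n * tree_gf $ n =
      (inverse (1 - (fps_X + fps_X ^ 3 * inverse (1 - fps_X))) ^ n) $ (n - 1)"
    by (rule lagrange_inversion[OF _ _ tree_gf_equation]) (use assms in \<open>simp_all add: tree_gf_def trees_0\<close>)
  also note nth_power_tree_series[OF assms]
  finally show ?thesis by (simp add: tree_gf_def)
qed

theorem theorem22:
  fixes n :: nat
  assumes "n \<ge> 1"
  shows "real (num_tree_interval_posets n) =
    (if n = 1 then 1
     else 1 / real n *
       ((\<Sum>i = 1..n - 3. \<Sum>k = 1..min i ((n - i - 1) div 2).
           real ((n + i - 1) choose i) * real (i choose k) * real ((n - i - k - 2) choose (k - 1)))
        + real ((2 * n - 2) choose (n - 1))))"
proof (cases "n = 1")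
  case True
  then show ?thesis using num_tree_interval_posets_eq[of 1] card_trees_1 by simp
next
  case False
  then have "n \<ge> 2" using assms by simp
  show ?thesis
    unfolding num_tree_interval_posets_eq[OF assms] card_trees_closed_form[OF \<open>n \<ge> 2\<close>, symmetric]
    using False assms by simp
qed

end
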